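(* Let $G$ be a signed multidigraph, $v\in V(G)$, $\gamma=\gamma_{\mathcal P}(G)$, $\gamma_r=\gamma_{\mathcal P}(r(G,v))$, $\gamma_v=\gamma_{\mathcal P}(G- v)$, and let $\lambda=0$ if $\gamma_v=\gamma_r$ and $\lambda=1$ otherwise. If $\gamma\geq 2$, then $0\leq \gamma_r-\gamma_v\leq 2$ and \[ I_{\gamma_r+k}(r^{k+\lambda+i}(G,v),X)= \left\langle \bigcup_{l=0}^{k} \widetilde{P}_{l}^{k+\lambda+i}(v) \cdot I_{\gamma_r+k-l}(G, X)|_{x_v=-1} \right\rangle, \] for all $k\geq 1$ and $i\geq 0$.
   Context: $\mathcal{P}$ is a principal ideal domain. A signed multidigraph $G$ is a finite multidigraph with signs $\pm1$ on its arcs; for distinct vertices $u,w$, $m_{uw}$ is the number of arcs from $u$ to $w$ and $\sigma(uw)$ their sign. With one variable $x_u$ per vertex, the generalized Laplacian $L(G,X)$ has diagonal entries $x_u$ and off-diagonal entries $-\sigma(uw)m_{uw}1_{\mathcal P}$. The critical ideal $I_i(G,X)$ is the ideal of $\mathcal P[X]$ generated by the $i\times i$ minors of $L(G,X)$, with $I_i(G,X)=\langle0\rangle$ for $i>|V(G)|$; the algebraic co-rank $\gamma_{\mathcal P}(G)$ is the largest $i$ with $I_i(G,X)=\langle 1\rangle$. $r^k(G,v)$ is obtained by replicating $v$ $k$ times: new vertices $v^1,\dots,v^k$ ($v^0=v$), each having exactly the arcs of $v$ (multiplicities, signs, both directions) to every vertex of $G-v$, and any two distinct $v^i,v^{i'}$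 joined by one positive arc in each direction; the variable of $v^i$ is $x_{v^i}$; $r(G,v)=r^1(G,v)$. $\widetilde P^k_l(v)=\{\prod_{c\in C}(x_{v^c}+1): C\subseteq\{0,\dots,k\}, |C|=l\}$, with $\widetilde P^k_0(v)=\{1\}$; $A\cdot B=\{ab:a\in A,b\in B\}$. $I|_{x_v=-1}$ is the ideal generated by the images under $x_v\mapsto -1$, viewed in the larger polynomial ring. *)

theory Defs
  imports
    "HOL-Library.Poly_Mapping"
    "HOL-Algebra.Ring_Divisibility"
    "Graph_Theory.Digraph"
    "Jordan_Normal_Form.Determinant"
    "Jordan_Normal_Form.VS_Connect"
begin

text \<open>
  Multivariate polynomials with coefficients in \<open>'a\<close> and one potential variable for every element
  of the type \<open>'x\<close>: finitely supported maps from monomials (exponent vectors) to coefficients.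
\<close>

type_synonym ('x, 'a) mpoly = "('x \<Rightarrow>\<^sub>0 nat) \<Rightarrow>\<^sub>0 'a"

definition MVar :: "'x \<Rightarrow> ('x, 'a::comm_ring_1) mpoly" where
  "MVar x = Poly_Mapping.single (Poly_Mapping.single x 1) 1"

definition MConst :: "'a \<Rightarrow> ('x, 'a::comm_ring_1) mpoly" where
  "MConst c = Poly_Mapping.single 0 c"

text \<open>The polynomial ring \<open>'a[x\<^sub>w : w \<in> W]\<close>.\<close>

definition poly_ring :: "'x set \<Rightarrow> ('x, 'a::comm_ring_1) mpoly ring" where
  "poly_ring W =
     \<lparr>carrier = {p. \<forall>m \<in> Poly_Mapping.keys p. Poly_Mapping.keys m \<subseteq> W},
      mult = (*), one = 1, zero = 0, add = (+)\<rparr>"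

definition mpoly_subst ::
    "('x \<Rightarrow> ('y, 'a) mpoly) \<Rightarrow> ('x, 'a::comm_ring_1) mpoly \<Rightarrow> ('y, 'a) mpoly" where
  "mpoly_subst f p =
     (\<Sum>m \<in> Poly_Mapping.keys p. MConst (Poly_Mapping.lookup p m) *
        (\<Prod>x \<in> Poly_Mapping.keys m. f x ^ Poly_Mapping.lookup m x))"

text \<open>
  Parallel arcs have the same sign, so that the sign of a pair of adjacent vertices makes sense.
  Loops are allowed but play no role: they do not contribute to the generalized Laplacian.
\<close>

locale signed_multidigraph = fin_digraph G
  for G :: "('v, 'e) pre_digraph" and sg :: "'e \<Rightarrow> int" +
  assumes sign_values: "e \<in> arcs G \<Longrightarrow> sg e = 1 \<or> sg e = -1"
    and sign_parallel: "\<lbrakk>e \<in> arcs G; f \<in> arcs G; arc_to_ends G e = arc_to_ends G f;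
      tail G e \<noteq> head G e\<rbrakk> \<Longrightarrow> sg e = sg f"

definition arcs_from_to :: "('v, 'e) pre_digraph \<Rightarrow> 'v \<Rightarrow> 'v \<Rightarrow> 'e set" where
  "arcs_from_to G u w = {e \<in> arcs G. arc_to_ends G e = (u, w)}"

definition arc_mult :: "('v, 'e) pre_digraph \<Rightarrow> 'v \<Rightarrow> 'v \<Rightarrow> nat" where
  "arc_mult G u w = card (arcs_from_to G u w)"

text \<open>Only meaningful for distinct \<open>u\<close>, \<open>w\<close> with at least one arc from \<open>u\<close> to \<open>w\<close>.\<close>

definition arc_sign :: "('v, 'e) pre_digraph \<Rightarrow> ('e \<Rightarrow> int) \<Rightarrow> 'v \<Rightarrow> 'v \<Rightarrow> int" where
  "arc_sign G sg u w = sg (SOME e. e \<in> arcs_from_to G u w)"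

definition gen_laplacian ::
    "('v, 'e) pre_digraph \<Rightarrow> ('e \<Rightarrow> int) \<Rightarrow> 'v \<Rightarrow> 'v \<Rightarrow> ('v, 'a::comm_ring_1) mpoly" where
  "gen_laplacian G sg u w =
     (if u = w then MVar u
      else MConst (- (of_int (arc_sign G sg u w) * of_nat (arc_mult G u w) * 1)))"

text \<open>
  The vertices carry no order, so rows and columns are chosen by repetition-free lists of vertices:
  every minor occurs together with its negative, which leaves the generated ideal unchanged.
  The only minor of size 0 is 1, and there are no minors of size larger than the number of vertices.
\<close>

definition laplacian_minors ::
    "('v, 'e) pre_digraph \<Rightarrow> ('e \<Rightarrow> int) \<Rightarrow> nat \<Rightarrow> ('v, 'a::comm_ring_1) mpoly set" where
  "laplacian_minors G sg i =
     {det (mat i i (\<lambda>(a, b). gen_laplacian G sg (rs ! a) (cs ! b))) | rs cs.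
        distinct rs \<and> set rs \<subseteq> verts G \<and> length rs = i \<and>
        distinct cs \<and> set cs \<subseteq> verts G \<and> length cs = i}"

definition critical_ideal ::
    "('v, 'e) pre_digraph \<Rightarrow> ('e \<Rightarrow> int) \<Rightarrow> nat \<Rightarrow> ('v, 'a::comm_ring_1) mpoly set" where
  "critical_ideal G sg i = Idl\<^bsub>poly_ring (verts G)\<^esub> (laplacian_minors G sg i)"

definition alg_corank ::
    "'a::comm_ring_1 itself \<Rightarrow> ('v, 'e) pre_digraph \<Rightarrow> ('e \<Rightarrow> int) \<Rightarrow> nat" where
  "alg_corank P G sg =
     (GREATEST i. (critical_ideal G sg i :: ('v, 'a) mpoly set) = Idl\<^bsub>poly_ring (verts G)\<^esub> {1})"

text \<open>
  Replication of the vertex \<open>v\<close>. The vertices \<open>w \<noteq> v\<close> of \<open>G\<close> become \<open>(w, 0)\<close>, and \<open>v\<^sup>i\<close> is \<open>(v, i)\<close>.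
  The arc \<open>Inl (e, i)\<close> is the arc \<open>e\<close> of \<open>G\<close> with \<open>v\<close> replaced by \<open>v\<^sup>i\<close>; there is one such copy for each
  \<open>i \<le> k\<close> if \<open>e\<close> joins \<open>v\<close> with another vertex, and only the one with \<open>i = 0\<close> otherwise.
  The arc \<open>Inr (i, j)\<close> goes from \<open>v\<^sup>i\<close> to \<open>v\<^sup>j\<close> and is positive.
\<close>

definition replicate_vert ::
    "('v, 'e) pre_digraph \<Rightarrow> 'v \<Rightarrow> nat \<Rightarrow> ('v \<times> nat, 'e \<times> nat + nat \<times> nat) pre_digraph" where
  "replicate_vert G v k =
     \<lparr>verts = (verts G - {v}) \<times> {0} \<union> {v} \<times> {0..k},
      arcs = {Inl (e, i) | e i. e \<in> arcs G \<and>
                 i \<le> (if (tail G e = v) \<noteq> (head G e = v) then k else 0)} \<union>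
             {Inr (i, j) | i j. i \<le> k \<and> j \<le> k \<and> i \<noteq> j},
      tail = (\<lambda>a. case a of Inl (e, i) \<Rightarrow> (tail G e, if tail G e = v then i else 0)
                          | Inr (i, j) \<Rightarrow> (v, i)),
      head = (\<lambda>a. case a of Inl (e, i) \<Rightarrow> (head G e, if head G e = v then i else 0)
                          | Inr (i, j) \<Rightarrow> (v, j))\<rparr>"

definition replicate_sign :: "('e \<Rightarrow> int) \<Rightarrow> 'e \<times> nat + nat \<times> nat \<Rightarrow> int" where
  "replicate_sign sg a = (case a of Inl (e, i) \<Rightarrow> sg e | Inr _ \<Rightarrow> 1)"

definition P_tilde :: "'v \<Rightarrow> nat \<Rightarrow> nat \<Rightarrow> ('v \<times> nat, 'a::comm_ring_1) mpoly set" where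
  "P_tilde v k l = {(\<Prod>c\<in>C. MVar (v, c) + 1) | C. C \<subseteq> {0..k} \<and> card C = l}"

text \<open>
  \<open>I|\<^bsub>x\<^sub>v = -1\<^esub>\<close>, as an ideal of \<open>'a[x\<^sub>w : w \<in> W]\<close>, where \<open>W\<close> is the vertex set of a replication of \<open>v\<close>;
  the variable of a vertex \<open>u \<noteq> v\<close> is named \<open>(u, 0)\<close> there.
\<close>

definition ideal_at_minus_one ::
    "('v \<times> nat) set \<Rightarrow> 'v \<Rightarrow> ('v, 'a::comm_ring_1) mpoly set \<Rightarrow> ('v \<times> nat, 'a) mpoly set" where
  "ideal_at_minus_one W v I =
     Idl\<^bsub>poly_ring W\<^esub> (mpoly_subst (\<lambda>u. if u = v then -1 else MVar (u, 0)) ` I)"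

end

theory Submission
  imports Defs
begin

text \<open>
  Put \<open>A = L(G)|\<^bsub>x\<^sub>v = -1\<^esub>\<close>. Writing \<open>x\<close> as \<open>-1 + (x + 1)\<close> on the copies of \<open>v\<close> shows that the Laplacian of
  \<open>r\<^sup>n(G, v)\<close> is \<open>A\<close> with the row and column of \<open>v\<close> repeated, plus a diagonal matrix \<open>D\<close> with entries
  \<open>x + 1\<close> on the copies. Expanding a minor along \<open>D\<close> gives products of entries of \<open>D\<close> with minors of \<open>A\<close>,
  since remaining minors with a repeated row or column vanish; products of more than \<open>k\<close> entries are
  redundant, because \<open>D = 0\<close> turns \<open>I\<^bsub>\<gamma>\<^sub>r\<^esub>(r(G, v)) = \<langle>1\<rangle>\<close> into \<open>I\<^bsub>\<gamma>\<^sub>r\<^esub>(A) = \<langle>1\<rangle>\<close>. Conversely, if \<open>v\<close> indexes a row or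
  a column of a minor \<open>m\<close> of \<open>A\<close>, representing it by a copy outside \<open>C\<close> (two different copies if \<open>v\<close> is
  both) and adding \<open>C\<close> to the rows and columns yields exactly \<open>m\<close> times the product over \<open>C\<close>; if \<open>v\<close> does
  not occur, one gets further terms with one factor less, handled by induction. Two different
  copies outside \<open>C\<close> are missing only if \<open>\<lambda> = 0\<close> and \<open>|C| = k\<close>, and then already the minors avoiding \<open>v\<close>
  generate \<open>\<langle>1\<rangle>\<close>. The bound \<open>\<gamma>\<^sub>r \<le> \<gamma>\<^sub>v + 2\<close> comes from expanding minors of \<open>A\<close> along the row and the column of \<open>v\<close>.
\<close>

section \<open>Minors\<close>

text \<open>Lists serve as row and column selections because the labels carry no order. The size is
  read off \<open>rs\<close> alone, so equality of the two lengths recurs as a hypothesis.\<close>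

definition minor :: "('u \<Rightarrow> 'w \<Rightarrow> 'r::comm_ring_1) \<Rightarrow> 'u list \<Rightarrow> 'w list \<Rightarrow> 'r" where
  "minor K rs cs = det (mat (length rs) (length rs) (\<lambda>(a, b). K (rs ! a) (cs ! b)))"

definition remove_nth :: "nat \<Rightarrow> 'u list \<Rightarrow> 'u list" where
  "remove_nth p xs = take p xs @ drop (Suc p) xs"

lemma length_remove_nth: "p < length xs \<Longrightarrow> length (remove_nth p xs) = length xs - 1"
  by (simp add: remove_nth_def)

lemma nth_remove_nth:
  "p < length xs \<Longrightarrow> i < length xs - 1 \<Longrightarrow>
    remove_nth p xs ! i = xs ! (if i < p then i else Suc i)"
  by (auto simp: remove_nth_def nth_append)

lemma set_remove_nth: "set (remove_nth p xs) \<subseteq> set xs"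
  using set_take_subset[of p xs] set_drop_subset[of "Suc p" xs] by (auto simp: remove_nth_def)

lemma distinct_remove_nth: "distinct xs \<Longrightarrow> distinct (remove_nth p xs)"
  by (auto simp: remove_nth_def set_take_disj_set_drop_if_distinct)

lemma nth_notin_remove_nth:
  assumes "distinct xs" "p < length xs"
  shows "xs ! p \<notin> set (remove_nth p xs)"
proof -
  have "distinct (take p xs @ xs ! p # drop (Suc p) xs)"
    using assms by (simp add: id_take_nth_drop[symmetric])
  then show ?thesis by (auto simp: remove_nth_def)
qed

lemma remove_nth_append_Cons [simp]: "remove_nth (length xs) (xs @ c # ys) = xs @ ys"
  by (simp add: remove_nth_def)

lemma minor_Nil [simp]: "minor K [] cs = 1"
  by (simp add: minor_def)

lemma minor_cong:
  assumes "length rs = length cs" "\<And>u w. u \<in> set rs \<Longrightarrow> w \<in> set cs \<Longrightarrow> K u w = K' u w"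
  shows "minor K rs cs = minor K' rs cs"
  unfolding minor_def by (rule arg_cong[of _ _ det]) (use assms in \<open>auto intro!: eq_matI\<close>)

lemma minor_map:
  assumes "length rs = length cs"
  shows "minor K (map f rs) (map g cs) = minor (\<lambda>u w. K (f u) (g w)) rs cs"
  unfolding minor_def by (rule arg_cong[of _ _ det]) (use assms in \<open>auto intro!: eq_matI\<close>)

lemma (in comm_ring_hom) minor_hom: "hom (minor K rs cs) = minor (\<lambda>u w. hom (K u w)) rs cs"
  unfolding minor_def hom_det[symmetric] by (rule arg_cong[of _ _ det]) (auto intro!: eq_matI)

text \<open>The route by which column statements are deduced from row statements.\<close>

lemma minor_transpose:
  assumes "length rs = length cs"
  shows "minor K rs cs = minor (\<lambda>u w. K w u) cs rs"
proof -
  let ?A = "mat (length rs) (length rs) (\<lambda>(a, b). K (rs ! a) (cs ! b))"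
  have "minor (\<lambda>u w. K w u) cs rs = det (transpose_mat ?A)"
    unfolding minor_def by (rule arg_cong[of _ _ det]) (use assms in \<open>auto intro!: eq_matI\<close>)
  also have "\<dots> = det ?A" by (rule det_transpose[where n = "length rs"]) simp
  finally show ?thesis by (simp add: minor_def)
qed

lemma minor_eq_rows:
  assumes "p < length rs" "p' < length rs" "p \<noteq> p'" "length rs = length cs"
    and "\<And>w. w \<in> set cs \<Longrightarrow> K (rs ! p) w = K (rs ! p') w"
  shows "minor K rs cs = 0"
  unfolding minor_def
  by (rule det_identical_rows[where n = "length rs" and i = p and j = p'])
    (use assms in \<open>auto simp: row_def\<close>)

lemma minor_row_expansion:
  assumes "length rs = length cs" "p < length rs"
  shows "minor K rs cs =
    (\<Sum>q<length cs. K (rs ! p) (cs ! q) * ((-1) ^ (p + q) * minor K (remove_nth p rs) (remove_nth q cs)))"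
proof -
  let ?A = "mat (length rs) (length rs) (\<lambda>(a, b). K (rs ! a) (cs ! b))"
  have "det ?A = (\<Sum>q<length rs. ?A $$ (p, q) * cofactor ?A p q)"
    by (rule laplace_expansion_row) (use assms in auto)
  also have "\<dots> = (\<Sum>q<length cs. K (rs ! p) (cs ! q) *
      ((-1) ^ (p + q) * minor K (remove_nth p rs) (remove_nth q cs)))"
  proof (rule sum.cong)
    fix q assume "q \<in> {..<length cs}"
    then have q: "q < length cs" by simp
    have "mat_delete ?A p q = mat (length (remove_nth p rs)) (length (remove_nth p rs))
        (\<lambda>(a, b). K (remove_nth p rs ! a) (remove_nth q cs ! b))"
      using assms q by (auto intro!: eq_matI simp: mat_delete_def length_remove_nth nth_remove_nth)
    then show "?A $$ (p, q) * cofactor ?A p q = K (rs ! p) (cs ! q) *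
        ((-1) ^ (p + q) * minor K (remove_nth p rs) (remove_nth q cs))"
      using assms q by (simp add: cofactor_def minor_def)
  qed (use assms in simp)
  finally show ?thesis by (simp add: minor_def)
qed

text \<open>Expand both minors along row \<open>p\<close>: the cofactors agree, and only the summand
  of column \<open>q\<close> differs.\<close>

lemma minor_change_entry:
  assumes len: "length rs = length cs" "p < length rs" "q < length cs"
    and dist: "distinct rs" "distinct cs"
    and eq: "\<And>u w. u \<in> set rs \<Longrightarrow> w \<in> set cs \<Longrightarrow> (u, w) \<noteq> (rs ! p, cs ! q) \<Longrightarrow> K u w = K' u w"
  shows "minor K rs cs = minor K' rs cs + (K (rs ! p) (cs ! q) - K' (rs ! p) (cs ! q)) *
    ((-1) ^ (p + q) * minor K (remove_nth p rs) (remove_nth q cs))"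
proof -
  let ?t = "\<lambda>q. (-1) ^ (p + q) * minor K (remove_nth p rs) (remove_nth q cs)"
  have t: "(-1) ^ (p + j) * minor K' (remove_nth p rs) (remove_nth j cs) = ?t j"
    if "j < length cs" for j
  proof -
    \<comment> \<open>Row \<open>p\<close> is gone and, \<open>rs\<close> being distinct, its label
      does not reappear, so the cofactor does not see the changed entry.\<close>
    have "minor K' (remove_nth p rs) (remove_nth j cs) = minor K (remove_nth p rs) (remove_nth j cs)"
    proof (rule minor_cong)
      show "length (remove_nth p rs) = length (remove_nth j cs)"
        using that len by (simp add: length_remove_nth)
    next
      fix u w assume "u \<in> set (remove_nth p rs)" "w \<in> set (remove_nth j cs)"
      moreover from this have "u \<noteq> rs ! p" using nth_notin_remove_nth[OF dist(1) len(2)] by auto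
      moreover from calculation have "u \<in> set rs" "w \<in> set cs"
        using set_remove_nth[of p rs] set_remove_nth[of j cs] by blast+
      ultimately show "K' u w = K u w" using eq[of u w] by simp
    qed
    then show ?thesis by simp
  qed
  have "minor K rs cs - minor K' rs cs = (\<Sum>j<length cs. (K (rs ! p) (cs ! j) - K' (rs ! p) (cs ! j)) * ?t j)"
    by (simp add: minor_row_expansion[OF len(1,2)] t left_diff_distrib sum_subtractf)
  also have "\<dots> = (\<Sum>j<length cs. if j = q then (K (rs ! p) (cs ! q) - K' (rs ! p) (cs ! q)) * ?t q else 0)"
  proof (rule sum.cong)
    fix j assume "j \<in> {..<length cs}"
    then have j: "j < length cs" by simp
    show "(K (rs ! p) (cs ! j) - K' (rs ! p) (cs ! j)) * ?t j =
        (if j = q then (K (rs ! p) (cs ! q) - K' (rs ! p) (cs ! q)) * ?t q else 0)"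
    proof (cases "j = q")
      case False
      then have "cs ! j \<noteq> cs ! q" using dist(2) len j nth_eq_iff_index_eq by blast
      then show ?thesis using False eq[of "rs ! p" "cs ! j"] len j by simp
    qed simp
  qed simp
  also have "\<dots> = (K (rs ! p) (cs ! q) - K' (rs ! p) (cs ! q)) * ?t q" using len by simp
  finally show ?thesis by (simp add: algebra_simps)
qed

text \<open>Prefixes of equal length put the changed entry on the diagonal of the submatrix, so its
  cofactor carries the sign 1.\<close>

lemma minor_change_entry_append:
  assumes len: "length rs = length cs" "length xs = length ys"
    and dist: "distinct (xs @ c # rs)" "distinct (ys @ e # cs)"
    and eq: "\<And>u w. u \<in> set (xs @ c # rs) \<Longrightarrow> w \<in> set (ys @ e # cs) \<Longrightarrow> (u, w) \<noteq> (c, e) \<Longrightarrow> K u w = K' u w"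
  shows "minor K (xs @ c # rs) (ys @ e # cs) =
    minor K' (xs @ c # rs) (ys @ e # cs) + (K c e - K' c e) * minor K (xs @ rs) (ys @ cs)"
proof -
  have "(xs @ c # rs) ! length xs = c" "(ys @ e # cs) ! length xs = e"
    "remove_nth (length xs) (xs @ c # rs) = xs @ rs" "remove_nth (length xs) (ys @ e # cs) = ys @ cs"
    using len by (simp_all add: remove_nth_def nth_append)
  then show ?thesis
    using minor_change_entry[of "xs @ c # rs" "ys @ e # cs" "length xs" "length xs" K K'] len dist eq
    by (simp del: remove_nth_append_Cons)
qed

section \<open>Matrices with repeated rows and columns plus a diagonal\<close>

text \<open>The shape of the Laplacian of a replicated graph, with \<open>\<pi>\<close> sending a
  copy to its original. The test \<open>u = w\<close> compares copies, not originals, so two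
  different copies of one vertex receive no diagonal term.\<close>

definition blowup :: "('w \<Rightarrow> 'u) \<Rightarrow> ('u \<Rightarrow> 'u \<Rightarrow> 'r::comm_ring_1) \<Rightarrow> ('w \<Rightarrow> 'r) \<Rightarrow> 'w \<Rightarrow> 'w \<Rightarrow> 'r" where
  "blowup \<pi> A d u w = A (\<pi> u) (\<pi> w) + (if u = w then d u else 0)"

lemma minor_eq_rows_mem:
  assumes "u \<in> set rs" "u' \<in> set rs" "u \<noteq> u'" "length rs = length cs"
    and "\<And>w. w \<in> set cs \<Longrightarrow> K u w = K u' w"
  shows "minor K rs cs = 0"
proof -
  obtain p p' where "p < length rs" "rs ! p = u" "p' < length rs" "rs ! p' = u'"
    using assms(1,2) by (auto simp: in_set_conv_nth)
  then show ?thesis using minor_eq_rows[of p rs p' cs K] assms by metis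
qed

text \<open>Replace \<open>d c\<close> by 0 and account for the change by
  \<open>minor_change_entry_append\<close>. After the replacement the rows \<open>c\<close> and
  \<open>r\<close> coincide, because \<open>r\<close> contributes no diagonal term either, and the
  minor vanishes.\<close>

lemma minor_blowup_remove_row:
  assumes len: "length rs = length cs" "length xs = length ys"
    and dist: "distinct (xs @ c # rs)" "distinct (ys @ c # cs)"
    and r: "r \<in> set (xs @ rs)" "\<pi> r = \<pi> c" "r \<in> set (ys @ cs) \<Longrightarrow> d r = 0"
  shows "minor (blowup \<pi> A d) (xs @ c # rs) (ys @ c # cs) = d c * minor (blowup \<pi> A d) (xs @ rs) (ys @ cs)"
proof -
  let ?d = "d(c := 0)"
  have rc: "r \<noteq> c" using r(1) dist by auto
  have "minor (blowup \<pi> A d) (xs @ c # rs) (ys @ c # cs) = minor (blowup \<pi> A ?d) (xs @ c # rs) (ys @ c # cs)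
      + (blowup \<pi> A d c c - blowup \<pi> A ?d c c) * minor (blowup \<pi> A d) (xs @ rs) (ys @ cs)"
    by (rule minor_change_entry_append[OF len dist]) (auto simp: blowup_def)
  also have "minor (blowup \<pi> A ?d) (xs @ c # rs) (ys @ c # cs) = 0"
    by (rule minor_eq_rows_mem[of c _ r]) (use len r rc in \<open>auto simp: blowup_def\<close>)
  also have "blowup \<pi> A d c c - blowup \<pi> A ?d c c = d c" by (simp add: blowup_def)
  finally show ?thesis by simp
qed

lemma minor_blowup_remove_rows:
  assumes len: "length rs = length cs" "length xs = length ys"
    and dist: "distinct (xs @ zs @ rs)" "distinct (ys @ zs @ cs)"
    and r: "r \<in> set (xs @ rs)" "\<And>c. c \<in> set zs \<Longrightarrow> \<pi> r = \<pi> c" "r \<in> set (ys @ cs) \<Longrightarrow> d r = 0"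
  shows "minor (blowup \<pi> A d) (xs @ zs @ rs) (ys @ zs @ cs) =
    (\<Prod>c\<in>set zs. d c) * minor (blowup \<pi> A d) (xs @ rs) (ys @ cs)"
  using dist r(2)
proof (induction zs)
  case Nil
  then show ?case by simp
next
  case (Cons c zs)
  have "minor (blowup \<pi> A d) (xs @ c # (zs @ rs)) (ys @ c # (zs @ cs)) =
      d c * minor (blowup \<pi> A d) (xs @ zs @ rs) (ys @ zs @ cs)"
    by (rule minor_blowup_remove_row[where r = r]) (use Cons.prems len r in auto)
  also have "minor (blowup \<pi> A d) (xs @ zs @ rs) (ys @ zs @ cs) =
      (\<Prod>c\<in>set zs. d c) * minor (blowup \<pi> A d) (xs @ rs) (ys @ cs)"
    by (rule Cons.IH) (use Cons.prems in auto)
  finally show ?case using Cons.prems by (simp add: mult.assoc)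
qed

text \<open>The diagonal part is symmetric, so transposing a blowup only transposes
  \<open>A\<close>.\<close>

lemma blowup_transpose: "blowup \<pi> (\<lambda>u w. A w u) d = (\<lambda>u w. blowup \<pi> A d w u)"
  by (auto simp: blowup_def fun_eq_iff)

lemma minor_blowup_remove_cols:
  assumes len: "length rs = length cs" "length xs = length ys"
    and dist: "distinct (xs @ zs @ rs)" "distinct (ys @ zs @ cs)"
    and r: "r \<in> set (ys @ cs)" "\<And>c. c \<in> set zs \<Longrightarrow> \<pi> r = \<pi> c" "r \<in> set (xs @ rs) \<Longrightarrow> d r = 0"
  shows "minor (blowup \<pi> A d) (xs @ zs @ rs) (ys @ zs @ cs) =
    (\<Prod>c\<in>set zs. d c) * minor (blowup \<pi> A d) (xs @ rs) (ys @ cs)"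
proof -
  have t: "minor (blowup \<pi> A d) rs' cs' = minor (blowup \<pi> (\<lambda>u w. A w u) d) cs' rs'"
    if "length rs' = length cs'" for rs' cs'
    using minor_transpose[OF that, of "blowup \<pi> A d"] by (simp only: blowup_transpose[of \<pi> A d])
  have "minor (blowup \<pi> A d) (xs @ zs @ rs) (ys @ zs @ cs) =
      minor (blowup \<pi> (\<lambda>u w. A w u) d) (ys @ zs @ cs) (xs @ zs @ rs)"
    by (rule t) (use len in simp)
  also have "\<dots> = (\<Prod>c\<in>set zs. d c) * minor (blowup \<pi> (\<lambda>u w. A w u) d) (ys @ cs) (xs @ rs)"
    by (rule minor_blowup_remove_rows) (use assms in auto)
  also have "minor (blowup \<pi> (\<lambda>u w. A w u) d) (ys @ cs) (xs @ rs) = minor (blowup \<pi> A d) (xs @ rs) (ys @ cs)"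
    by (rule t[symmetric]) (use len in simp)
  finally show ?thesis .
qed

text \<open>Split the minor by the diagonal entry of the first copy \<open>z\<close>. The part with
  \<open>d z\<close> has one copy fewer and goes to the induction hypothesis; in the part without
  it, row \<open>z\<close> allows all other copies to be removed at the cost of their diagonal
  entries.\<close>

lemma minor_blowup_expand:
  assumes len: "length rs = length cs"
    and dist: "distinct (zs @ rs)" "distinct (zs @ cs)"
    and z: "\<And>c. c \<in> set zs \<Longrightarrow> \<pi> c = v"
  shows "minor (blowup \<pi> A d) (zs @ rs) (zs @ cs) =
    (\<Prod>c\<in>set zs. d c) * minor (blowup \<pi> A d) rs cs +
    (\<Sum>e\<in>set zs. (\<Prod>c\<in>set zs - {e}. d c) * minor (blowup \<pi> A (d(e := 0))) (e # rs) (e # cs))"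
proof -
  define M where "M e = minor (blowup \<pi> A (d(e := 0))) (e # rs) (e # cs)" for e
  have "minor (blowup \<pi> A d) (zs @ rs) (zs @ cs) =
    (\<Prod>c\<in>set zs. d c) * minor (blowup \<pi> A d) rs cs + (\<Sum>e\<in>set zs. (\<Prod>c\<in>set zs - {e}. d c) * M e)"
    using dist z
  proof (induction zs)
    case Nil
    then show ?case by simp
  next
    case (Cons z zs)
    let ?d = "d(z := 0)"
    have z: "z \<notin> set zs" "z \<notin> set rs" "z \<notin> set cs" using Cons.prems by auto
    have "minor (blowup \<pi> A d) ([] @ z # (zs @ rs)) ([] @ z # (zs @ cs)) =
        minor (blowup \<pi> A ?d) ([] @ z # (zs @ rs)) ([] @ z # (zs @ cs))
        + (blowup \<pi> A d z z - blowup \<pi> A ?d z z) * minor (blowup \<pi> A d) ([] @ zs @ rs) ([] @ zs @ cs)"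
      by (rule minor_change_entry_append) (use Cons.prems len in \<open>auto simp: blowup_def\<close>)
    \<comment> \<open>Here \<open>z\<close> plays the part of the reference row \<open>r\<close>,
      which is permitted since its diagonal term is now 0.\<close>
    also have "minor (blowup \<pi> A ?d) ([] @ z # (zs @ rs)) ([] @ z # (zs @ cs)) = (\<Prod>c\<in>set zs. ?d c) * M z"
      using minor_blowup_remove_rows[of rs cs "[z]" "[z]" zs z \<pi> ?d A] Cons.prems len by (simp add: M_def)
    also have "(\<Prod>c\<in>set zs. ?d c) = (\<Prod>c\<in>set zs. d c)"
      by (rule prod.cong) (use z in auto)
    also have "blowup \<pi> A d z z - blowup \<pi> A ?d z z = d z" by (simp add: blowup_def)
    also have "minor (blowup \<pi> A d) ([] @ zs @ rs) ([] @ zs @ cs) = (\<Prod>c\<in>set zs. d c) * minor (blowup \<pi> A d) rs cs +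
        (\<Sum>e\<in>set zs. (\<Prod>c\<in>set zs - {e}. d c) * M e)"
      using Cons by simp
    finally have step: "minor (blowup \<pi> A d) ((z # zs) @ rs) ((z # zs) @ cs) = (\<Prod>c\<in>set zs. d c) * M z +
        d z * ((\<Prod>c\<in>set zs. d c) * minor (blowup \<pi> A d) rs cs + (\<Sum>e\<in>set zs. (\<Prod>c\<in>set zs - {e}. d c) * M e))"
      by simp
    have "(\<Sum>e\<in>set zs. (\<Prod>c\<in>set (z # zs) - {e}. d c) * M e) =
        d z * (\<Sum>e\<in>set zs. (\<Prod>c\<in>set zs - {e}. d c) * M e)"
      unfolding sum_distrib_left
    proof (rule sum.cong)
      fix e assume "e \<in> set zs"
      then have "set (z # zs) - {e} = insert z (set zs - {e})" using z by auto
      then show "(\<Prod>c\<in>set (z # zs) - {e}. d c) * M e = d z * ((\<Prod>c\<in>set zs - {e}. d c) * M e)"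
        using z by (simp add: mult.assoc)
    qed simp
    moreover have "set (z # zs) - {z} = set zs" using z by auto
    ultimately show ?case unfolding step using z by (simp add: algebra_simps)
  qed
  then show ?thesis by (simp add: M_def)
qed

lemma minor_blowup_const:
  assumes "length rs = length cs" "\<And>u. u \<in> set rs \<Longrightarrow> u \<in> set cs \<Longrightarrow> d u = 0"
  shows "minor (blowup \<pi> A d) rs cs = minor A (map \<pi> rs) (map \<pi> cs)"
  unfolding minor_map[OF assms(1)] by (rule minor_cong) (use assms in \<open>auto simp: blowup_def\<close>)

lemma minor_not_distinct:
  assumes "length rs = length cs" "\<not> (distinct rs \<and> distinct cs)"
  shows "minor K rs cs = 0"
proof -
  \<comment> \<open>Fresh type variables make the claim applicable to \<open>K\<close> and to its
    transpose.\<close>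
  have *: "minor K rs cs = 0" if nd: "\<not> distinct rs" and len: "length rs = length cs"
    for K :: "'d \<Rightarrow> 'e \<Rightarrow> 'f::comm_ring_1" and rs cs
  proof -
    obtain p p' where "p < length rs" "p' < length rs" "p \<noteq> p'" "rs ! p = rs ! p'"
      using nd by (auto simp: distinct_conv_nth)
    then show ?thesis using minor_eq_rows[of p rs p' cs K] len by metis
  qed
  show ?thesis
  proof (cases "distinct rs")
    case True
    then show ?thesis using assms *[of cs rs "\<lambda>u w. K w u"] minor_transpose[of rs cs K] by simp
  next
    case False then show ?thesis using * assms by blast
  qed
qed

text \<open>The factor \<open>e\<close> lets the induction on \<open>Y\<close> collect the diagonal entries removed so far.\<close>

lemma minor_blowup_mem:
  fixes A :: "'u \<Rightarrow> 'u \<Rightarrow> 'r::comm_ring_1"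
  assumes "finite Y"
    and I: "0 \<in> I" "\<And>a b. a \<in> I \<Longrightarrow> b \<in> I \<Longrightarrow> a + b \<in> I" 
    and gen: "\<And>C rs' cs'. C \<subseteq> Y \<Longrightarrow> distinct rs' \<Longrightarrow> distinct cs' \<Longrightarrow> set rs' \<subseteq> \<pi> ` set rs \<Longrightarrow>
       set cs' \<subseteq> \<pi> ` set cs \<Longrightarrow> length rs' = length cs' \<Longrightarrow> length rs' + card C = length rs \<Longrightarrow>
       e * (\<Prod>c\<in>C. y c) * minor A rs' cs' \<in> I"
    and neg: "\<And>a. a \<in> I \<Longrightarrow> - a \<in> I"
    and "distinct rs" "distinct cs" "length rs = length cs"
  shows "e * minor (blowup \<pi> A (\<lambda>u. if u \<in> Y then y u else 0)) rs cs \<in> I"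
  using assms(1) gen assms(6-)
proof (induction Y arbitrary: e rs cs)
  case empty
  have *: "minor (blowup \<pi> A (\<lambda>u. if u \<in> {} then y u else 0)) rs cs = minor A (map \<pi> rs) (map \<pi> cs)"
    by (rule minor_blowup_const) (use empty in auto)
  show ?case
  proof (cases "distinct (map \<pi> rs) \<and> distinct (map \<pi> cs)")
    case True
    then show ?thesis unfolding * using empty(1)[of "{}" "map \<pi> rs" "map \<pi> cs"] empty(4) by auto
  next
    case False
    then have "minor A (map \<pi> rs) (map \<pi> cs) = 0" by (intro minor_not_distinct) (use empty in auto)
    then show ?thesis unfolding * using I(1) by simp
  qed
next
  case (insert z Y)
  let ?B = "\<lambda>Y. blowup \<pi> A (\<lambda>u. if u \<in> Y then y u else 0)"
  have IH: "e * minor (?B Y) rs cs \<in> I"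
  proof (rule insert.IH)
    fix C assume "C \<subseteq> Y"
    then have "C \<subseteq> insert z Y" by blast
    then show "e * (\<Prod>c\<in>C. y c) * minor A rs' cs' \<in> I"
      if "distinct rs'" "distinct cs'" "set rs' \<subseteq> \<pi> ` set rs" "set cs' \<subseteq> \<pi> ` set cs"
        "length rs' = length cs'" "length rs' + card C = length rs" for rs' cs'
      by (rule insert.prems(1)) (use that in auto)
  qed (use insert.prems in auto)
  show ?case
  proof (cases "z \<in> set rs \<and> z \<in> set cs")
    case False
    have "minor (?B (insert z Y)) rs cs = minor (?B Y) rs cs"
      by (rule minor_cong) (use False insert.prems in \<open>auto simp: blowup_def\<close>)
    then show ?thesis using IH by simp
  next
    case True
    obtain p q where pq: "p < length rs" "rs ! p = z" "q < length cs" "cs ! q = z"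
      using True by (auto simp: in_set_conv_nth)
    let ?s = "(-1) ^ (p + q) :: 'r"
    have "minor (?B (insert z Y)) rs cs = minor (?B Y) rs cs + ?s * (y z * minor (?B Y) (remove_nth p rs) (remove_nth q cs))"
    proof -
      \<comment> \<open>Once row \<open>z\<close> is removed, the diagonal term at \<open>z\<close>
        no longer occurs.\<close>
      have K: "minor (?B Y) (remove_nth p rs) (remove_nth q cs) = minor (?B (insert z Y)) (remove_nth p rs) (remove_nth q cs)"
        by (rule minor_cong) (use pq insert.prems nth_notin_remove_nth[of rs p]
            in \<open>auto simp: blowup_def length_remove_nth\<close>)
      have y: "?B (insert z Y) z z - ?B Y z z = y z" using insert.hyps by (simp add: blowup_def)
      have "minor (?B (insert z Y)) rs cs = minor (?B Y) rs cs +
          (?B (insert z Y) (rs ! p) (cs ! q) - ?B Y (rs ! p) (cs ! q)) *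
          (?s * minor (?B (insert z Y)) (remove_nth p rs) (remove_nth q cs))"
        by (rule minor_change_entry) (use insert.prems pq in \<open>auto simp: blowup_def\<close>)
      then show ?thesis unfolding pq y K by (simp only: mult.left_commute)
    qed
    \<comment> \<open>The extracted entry \<open>y z\<close> joins the collected factor; in the
      generators it enlarges \<open>C\<close> to \<open>insert z C\<close>.\<close>
    moreover have "e * y z * minor (?B Y) (remove_nth p rs) (remove_nth q cs) \<in> I"
    proof (rule insert.IH)
      fix C rs' cs'
      assume C: "C \<subseteq> Y" "length rs' + card C = length (remove_nth p rs)"
        and *: "distinct rs'" "distinct cs'" "set rs' \<subseteq> \<pi> ` set (remove_nth p rs)"
         "set cs' \<subseteq> \<pi> ` set (remove_nth q cs)" "length rs' = length cs'"
      have "finite C" "z \<notin> C" using C insert.hyps finite_subset by auto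
      moreover have "set rs' \<subseteq> \<pi> ` set rs" "set cs' \<subseteq> \<pi> ` set cs"
        using *(3,4) set_remove_nth[of p rs] set_remove_nth[of q cs] by blast+
      ultimately have "e * (\<Prod>c\<in>insert z C. y c) * minor A rs' cs' \<in> I"
        by (intro insert.prems(1)) (use C *(1,2,5) pq insert.prems(4) in \<open>auto simp: length_remove_nth\<close>)
      then show "e * y z * (\<Prod>c\<in>C. y c) * minor A rs' cs' \<in> I"
        using \<open>finite C\<close> \<open>z \<notin> C\<close> by (simp add: mult.assoc)
    qed (use insert.prems pq in \<open>auto simp: length_remove_nth distinct_remove_nth\<close>)
    ultimately have eq: "e * minor (?B (insert z Y)) rs cs = e * minor (?B Y) rs cs +
          ?s * (e * y z * minor (?B Y) (remove_nth p rs) (remove_nth q cs))"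
        and mem: "e * y z * minor (?B Y) (remove_nth p rs) (remove_nth q cs) \<in> I"
      by (simp_all only: distrib_left mult.left_commute mult.assoc)
    \<comment> \<open>The sign needs only closure under negation; all other ring factors already sit
      in the collected factor, so \<open>I\<close> need only be an additive group.\<close>
    have "?s * (e * y z * minor (?B Y) (remove_nth p rs) (remove_nth q cs)) \<in> I"
      using mem neg[OF mem] by (cases "even (p + q)") simp_all
    then show ?thesis unfolding eq using IH I(2) by blast
  qed
qed

section \<open>Ideals and substitutions in multivariate polynomial rings\<close>

lemma poly_ring_simps [simp]:
  "mult (poly_ring W) = (*)" "one (poly_ring W) = 1" "zero (poly_ring W) = 0" "add (poly_ring W) = (+)"
  by (simp_all add: poly_ring_def)

lemma mem_poly_ring: "p \<in> carrier (poly_ring W) \<longleftrightarrow> (\<forall>m\<in>Poly_Mapping.keys p. Poly_Mapping.keys m \<subseteq> W)"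
  by (simp add: poly_ring_def)

lemma poly_ring_0 [simp]: "0 \<in> carrier (poly_ring W)"
  by (simp add: mem_poly_ring)

lemma MConst_in_poly_ring [simp]: "MConst c \<in> carrier (poly_ring W)"
  by (simp add: mem_poly_ring MConst_def)

lemma MConst_1: "MConst 1 = 1"
  by (simp add: MConst_def)

lemma poly_ring_1 [simp]: "1 \<in> carrier (poly_ring W)"
  unfolding MConst_1[symmetric] by (rule MConst_in_poly_ring)

lemma MVar_in_poly_ring [simp]: "x \<in> W \<Longrightarrow> MVar x \<in> carrier (poly_ring W)"
  by (simp add: mem_poly_ring MVar_def)

lemma poly_ring_add [intro]:
  "p \<in> carrier (poly_ring W) \<Longrightarrow> q \<in> carrier (poly_ring W) \<Longrightarrow> p + q \<in> carrier (poly_ring W)"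
  using Poly_Mapping.keys_add[of p q] by (auto simp: mem_poly_ring)

lemma poly_ring_uminus [intro]: "p \<in> carrier (poly_ring W) \<Longrightarrow> - p \<in> carrier (poly_ring W)"
  by (simp add: mem_poly_ring)

lemma poly_ring_mult [intro]:
  assumes "p \<in> carrier (poly_ring W)" "q \<in> carrier (poly_ring W)"
  shows "p * q \<in> carrier (poly_ring W)"
  unfolding mem_poly_ring
proof
  fix m assume "m \<in> Poly_Mapping.keys (p * q)"
  then obtain a b where "m = a + b" "a \<in> Poly_Mapping.keys p" "b \<in> Poly_Mapping.keys q"
    using keys_mult[of p q] by auto
  then show "Poly_Mapping.keys m \<subseteq> W"
    using assms Poly_Mapping.keys_add[of a b] by (fastforce simp: mem_poly_ring)
qed

lemma poly_ring_sum [intro]: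
  "(\<And>a. a \<in> A \<Longrightarrow> f a \<in> carrier (poly_ring W)) \<Longrightarrow> sum f A \<in> carrier (poly_ring W)"
  by (induction A rule: infinite_finite_induct) auto

lemma poly_ring_prod [intro]:
  "(\<And>a. a \<in> A \<Longrightarrow> f a \<in> carrier (poly_ring W)) \<Longrightarrow> prod f A \<in> carrier (poly_ring W)"
  by (induction A rule: infinite_finite_induct) auto

lemma poly_ring_power [intro]: "p \<in> carrier (poly_ring W) \<Longrightarrow> p ^ n \<in> carrier (poly_ring W)"
  by (induction n) auto

lemma cring_poly_ring: "cring (poly_ring W :: ('x, 'a::comm_ring_1) mpoly ring)"
proof (rule cringI)
  show "abelian_group (poly_ring W :: ('x, 'a) mpoly ring)"
  proof (rule abelian_groupI)
    fix p :: "('x, 'a) mpoly" assume "p \<in> carrier (poly_ring W)"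
    then show "\<exists>q\<in>carrier (poly_ring W). q \<oplus>\<^bsub>poly_ring W\<^esub> p = \<zero>\<^bsub>poly_ring W\<^esub>"
      by (intro bexI[of _ "- p"]) auto
  qed (auto simp: add.assoc add.commute)
  show "comm_monoid (poly_ring W :: ('x, 'a) mpoly ring)"
    by (rule comm_monoidI) (auto simp: mult.assoc mult.commute)
qed (auto simp: distrib_right)

lemma poly_ring_idealI:
  fixes I :: "('x, 'a::comm_ring_1) mpoly set"
  assumes "I \<subseteq> carrier (poly_ring W)" "0 \<in> I" "\<And>a b. a \<in> I \<Longrightarrow> b \<in> I \<Longrightarrow> a + b \<in> I"
    and mult: "\<And>a b. a \<in> carrier (poly_ring W) \<Longrightarrow> b \<in> I \<Longrightarrow> a * b \<in> I"
  shows "ideal I (poly_ring W)"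
proof (rule idealI)
  interpret cring "poly_ring W :: ('x, 'a) mpoly ring" by (rule cring_poly_ring)
  show "ring (poly_ring W :: ('x, 'a) mpoly ring)" by (rule ring_axioms)
  show "subgroup I (add_monoid (poly_ring W))"
  proof (rule add.subgroupI)
    fix a assume a: "a \<in> I"
    have "\<ominus>\<^bsub>poly_ring W\<^esub> a = - a" by (rule minus_equality) (use a assms(1) in auto)
    also have "- a = (- 1) * a" by simp
    also have "\<dots> \<in> I" by (rule mult) (use a in auto)
    finally show "\<ominus>\<^bsub>poly_ring W\<^esub> a \<in> I" .
  qed (use assms in auto)
  fix a x :: "('x, 'a) mpoly" assume "a \<in> I" "x \<in> carrier (poly_ring W)"
  then have "x * a \<in> I" by (intro mult)
  then show "x \<otimes>\<^bsub>poly_ring W\<^esub> a \<in> I" "a \<otimes>\<^bsub>poly_ring W\<^esub> x \<in> I"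
    by (simp_all add: mult.commute[of a x])
qed

text \<open>Translates the record-based notion of ideal into the type class operations, in which the
  determinant calculations take place.\<close>

lemma ideal_poly_ring:
  assumes "ideal I (poly_ring W)"
  shows ideal_poly_ring_subset: "I \<subseteq> carrier (poly_ring W)"
    and ideal_poly_ring_0: "0 \<in> I"
    and ideal_poly_ring_add: "\<And>a b. a \<in> I \<Longrightarrow> b \<in> I \<Longrightarrow> a + b \<in> I"
    and ideal_poly_ring_mult: "\<And>a b. a \<in> carrier (poly_ring W) \<Longrightarrow> b \<in> I \<Longrightarrow> a * b \<in> I"
    and ideal_poly_ring_uminus: "\<And>a. a \<in> I \<Longrightarrow> - a \<in> I"
    and ideal_poly_ring_sum: "\<And>A f. (\<And>i. i \<in> A \<Longrightarrow> f i \<in> I) \<Longrightarrow> sum f A \<in> I"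
proof -
  interpret ideal I "poly_ring W" by fact
  show "I \<subseteq> carrier (poly_ring W)" by (rule a_subset)
  show 0: "0 \<in> I" using additive_subgroup.zero_closed[OF is_additive_subgroup] by simp
  show add: "\<And>a b. a \<in> I \<Longrightarrow> b \<in> I \<Longrightarrow> a + b \<in> I"
    using additive_subgroup.a_closed[OF is_additive_subgroup] by simp
  show mult: "\<And>a b. a \<in> carrier (poly_ring W) \<Longrightarrow> b \<in> I \<Longrightarrow> a * b \<in> I" using I_l_closed by simp
  show "- a \<in> I" if "a \<in> I" for a using mult[of "- 1" a] that by (simp add: poly_ring_uminus)
  show "sum f A \<in> I" if "\<And>i. i \<in> A \<Longrightarrow> f i \<in> I" for A :: "'c set" and f
    using that by (induction A rule: infinite_finite_induct) (auto intro: 0 add)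
qed

lemma Idl_poly_ring:
  assumes "S \<subseteq> carrier (poly_ring W)"
  shows ideal_Idl: "ideal (Idl\<^bsub>poly_ring W\<^esub> S) (poly_ring W)"
    and Idl_superset: "S \<subseteq> Idl\<^bsub>poly_ring W\<^esub> S"
    and Idl_least: "\<And>I. ideal I (poly_ring W) \<Longrightarrow> S \<subseteq> I \<Longrightarrow> Idl\<^bsub>poly_ring W\<^esub> S \<subseteq> I"
proof -
  interpret cring "poly_ring W" by (rule cring_poly_ring)
  show "ideal (Idl\<^bsub>poly_ring W\<^esub> S) (poly_ring W)" by (rule genideal_ideal[OF assms])
  show "S \<subseteq> Idl\<^bsub>poly_ring W\<^esub> S" by (rule genideal_self[OF assms])
  show "\<And>I. ideal I (poly_ring W) \<Longrightarrow> S \<subseteq> I \<Longrightarrow> Idl\<^bsub>poly_ring W\<^esub> S \<subseteq> I" by (rule genideal_minimal)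
qed

text \<open>The ring elements satisfying \<open>Q\<close> form an ideal containing the generators,
  and the generated ideal is the least such.\<close>

lemma Idl_induct [consumes 2, case_names gen zero add mult]:
  assumes "x \<in> Idl\<^bsub>poly_ring W\<^esub> S" "S \<subseteq> carrier (poly_ring W)"
    and "\<And>s. s \<in> S \<Longrightarrow> Q s" "Q 0"
    and "\<And>a b. Q a \<Longrightarrow> Q b \<Longrightarrow> Q (a + b)"
    and "\<And>a b. a \<in> carrier (poly_ring W) \<Longrightarrow> Q b \<Longrightarrow> Q (a * b)"
  shows "Q x"
proof -
  have "ideal {x \<in> carrier (poly_ring W). Q x} (poly_ring W)"
    by (rule poly_ring_idealI) (use assms in auto)
  from Idl_least[OF assms(2) this] show ?thesis using assms by auto
qed

text \<open>Both sides express that the ideal is the whole ring. This turns the condition defining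
  the co-rank into membership of 1.\<close>

lemma ideal_eq_Idl_1_iff:
  assumes "ideal I (poly_ring W)"
  shows "I = Idl\<^bsub>poly_ring W\<^esub> {1} \<longleftrightarrow> 1 \<in> I"
proof
  assume "I = Idl\<^bsub>poly_ring W\<^esub> {1}"
  then show "1 \<in> I" using Idl_superset[of "{1}" W] by auto
next
  assume "1 \<in> I"
  then have "x \<in> I \<longleftrightarrow> x \<in> carrier (poly_ring W)" for x
    using ideal_poly_ring_mult[OF assms, of x 1] ideal_poly_ring_subset[OF assms] by auto
  moreover have one: "{1} \<subseteq> carrier (poly_ring W)" by simp
  have "x \<in> Idl\<^bsub>poly_ring W\<^esub> {1} \<longleftrightarrow> x \<in> carrier (poly_ring W)" for x
    using ideal_poly_ring_mult[OF ideal_Idl[OF one], of x 1] Idl_superset[OF one]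
      ideal_poly_ring_subset[OF ideal_Idl[OF one]] by auto
  ultimately show "I = Idl\<^bsub>poly_ring W\<^esub> {1}" by blast
qed

lemma Idl_hom_image:
  assumes "comm_ring_hom h" "h ` carrier (poly_ring W) \<subseteq> carrier (poly_ring W')" "S \<subseteq> carrier (poly_ring W)"
  shows "h ` (Idl\<^bsub>poly_ring W\<^esub> S) \<subseteq> Idl\<^bsub>poly_ring W'\<^esub> (h ` S)"
proof
  interpret comm_ring_hom h by fact
  have S': "h ` S \<subseteq> carrier (poly_ring W')" using assms by blast
  note I = ideal_Idl[OF S']
  fix y assume "y \<in> h ` (Idl\<^bsub>poly_ring W\<^esub> S)"
  then obtain x where x: "x \<in> Idl\<^bsub>poly_ring W\<^esub> S" "y = h x" by auto
  show "y \<in> Idl\<^bsub>poly_ring W'\<^esub> (h ` S)" unfolding x(2)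
    using x(1) assms(3)
  proof (induction rule: Idl_induct)
    case (gen s)
    then show ?case using Idl_superset[OF S'] by auto
  next
    case zero
    then show ?case using ideal_poly_ring_0[OF I] by simp
  next
    case (add a b)
    then show ?case using ideal_poly_ring_add[OF I] by (simp add: hom_add)
  next
    case (mult a b)
    then show ?case using ideal_poly_ring_mult[OF I] assms(2) by (auto simp: hom_mult)
  qed
qed

text \<open>Under a substitution it suffices to transform generators; the outer \<open>Idl\<close>
  is needed because the image of an ideal need not be an ideal.\<close>

lemma Idl_hom_image_Idl:
  assumes "comm_ring_hom h" "h ` carrier (poly_ring W) \<subseteq> carrier (poly_ring W')" "S \<subseteq> carrier (poly_ring W)"
  shows "Idl\<^bsub>poly_ring W'\<^esub> (h ` (Idl\<^bsub>poly_ring W\<^esub> S)) = Idl\<^bsub>poly_ring W'\<^esub> (h ` S)"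
proof
  have S': "h ` S \<subseteq> carrier (poly_ring W')" using assms by blast
  have T: "h ` (Idl\<^bsub>poly_ring W\<^esub> S) \<subseteq> carrier (poly_ring W')"
    using ideal_poly_ring_subset[OF ideal_Idl[OF assms(3)]] assms(2) by blast
  show "Idl\<^bsub>poly_ring W'\<^esub> (h ` (Idl\<^bsub>poly_ring W\<^esub> S)) \<subseteq> Idl\<^bsub>poly_ring W'\<^esub> (h ` S)"
    by (rule Idl_least[OF T ideal_Idl[OF S'] Idl_hom_image[OF assms]])
  show "Idl\<^bsub>poly_ring W'\<^esub> (h ` S) \<subseteq> Idl\<^bsub>poly_ring W'\<^esub> (h ` (Idl\<^bsub>poly_ring W\<^esub> S))"
    by (rule Idl_least[OF S' ideal_Idl[OF T]])
      (use Idl_superset[OF assms(3)] Idl_superset[OF T] in blast)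
qed

section \<open>Substitution as a ring homomorphism\<close>

definition monom_subst :: "('x \<Rightarrow> 'r::comm_ring_1) \<Rightarrow> ('x \<Rightarrow>\<^sub>0 nat) \<Rightarrow> 'r" where
  "monom_subst f m = (\<Prod>x\<in>Poly_Mapping.keys m. f x ^ Poly_Mapping.lookup m x)"

text \<open>Variables outside the monomial contribute the power 0. A common index set makes products
  over different monomials comparable.\<close>

lemma monom_subst_superset:
  assumes "finite X" "Poly_Mapping.keys m \<subseteq> X"
  shows "monom_subst f m = (\<Prod>x\<in>X. f x ^ Poly_Mapping.lookup m x)"
  unfolding monom_subst_def
  by (rule prod.mono_neutral_left) (use assms in \<open>auto simp: in_keys_iff\<close>)

lemma monom_subst_add: "monom_subst f (m + m') = monom_subst f m * monom_subst f m'"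
proof -
  let ?X = "Poly_Mapping.keys m \<union> Poly_Mapping.keys m'"
  have "monom_subst f (m + m') = (\<Prod>x\<in>?X. f x ^ Poly_Mapping.lookup (m + m') x)"
    by (rule monom_subst_superset) (use Poly_Mapping.keys_add[of m m'] in auto)
  also have "\<dots> = (\<Prod>x\<in>?X. f x ^ Poly_Mapping.lookup m x) * (\<Prod>x\<in>?X. f x ^ Poly_Mapping.lookup m' x)"
    by (simp add: Poly_Mapping.lookup_add power_add prod.distrib)
  also have "(\<Prod>x\<in>?X. f x ^ Poly_Mapping.lookup m x) = monom_subst f m"
    by (rule monom_subst_superset[symmetric]) auto
  also have "(\<Prod>x\<in>?X. f x ^ Poly_Mapping.lookup m' x) = monom_subst f m'"
    by (rule monom_subst_superset[symmetric]) auto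
  finally show ?thesis .
qed

lemma mpoly_subst_superset:
  assumes "finite X" "Poly_Mapping.keys p \<subseteq> X"
  shows "mpoly_subst f p = (\<Sum>m\<in>X. MConst (Poly_Mapping.lookup p m) * monom_subst f m)"
  unfolding mpoly_subst_def monom_subst_def
  by (rule sum.mono_neutral_left) (use assms in \<open>auto simp: in_keys_iff MConst_def\<close>)

lemma MConst_add: "MConst (a + b) = MConst a + MConst b"
  by (simp add: MConst_def single_add)

lemma MConst_mult: "MConst (a * b) = MConst a * MConst b"
  by (simp add: MConst_def mult_single)

lemma mpoly_subst_add: "mpoly_subst f (p + q) = mpoly_subst f p + mpoly_subst f q"
proof -
  let ?X = "Poly_Mapping.keys p \<union> Poly_Mapping.keys q"
  have "mpoly_subst f (p + q) = (\<Sum>m\<in>?X. MConst (Poly_Mapping.lookup (p + q) m) * monom_subst f m)"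
    by (rule mpoly_subst_superset) (use Poly_Mapping.keys_add[of p q] in auto)
  also have "\<dots> = (\<Sum>m\<in>?X. MConst (Poly_Mapping.lookup p m) * monom_subst f m) +
      (\<Sum>m\<in>?X. MConst (Poly_Mapping.lookup q m) * monom_subst f m)"
    by (simp add: Poly_Mapping.lookup_add MConst_add distrib_right sum.distrib)
  also have "(\<Sum>m\<in>?X. MConst (Poly_Mapping.lookup p m) * monom_subst f m) = mpoly_subst f p"
    by (rule mpoly_subst_superset[symmetric]) auto
  also have "(\<Sum>m\<in>?X. MConst (Poly_Mapping.lookup q m) * monom_subst f m) = mpoly_subst f q"
    by (rule mpoly_subst_superset[symmetric]) auto
  finally show ?thesis .
qed

lemma mpoly_subst_single: "mpoly_subst f (Poly_Mapping.single m c) = MConst c * monom_subst f m"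
  by (subst mpoly_subst_superset[of "{m}"]) auto

lemma mpoly_subst_0 [simp]: "mpoly_subst f 0 = 0"
  by (simp add: mpoly_subst_def)

text \<open>Setting a coefficient at a monomial that does not yet occur amounts to adding a single
  term.\<close>

lemma mpoly_induct [case_names zero single_add]:
  assumes "Q 0" "\<And>p m c. Q p \<Longrightarrow> Q (Poly_Mapping.single m c + p)"
  shows "Q (p :: 'm \<Rightarrow>\<^sub>0 'a::comm_ring_1)"
proof (induction p rule: update_induct)
  case const
  then show ?case by (rule assms)
next
  case (update p m c)
  have "Poly_Mapping.update m c p = Poly_Mapping.single m c + p"
    by (rule poly_mapping_eqI)
      (use update(1) in \<open>auto simp: lookup_update Poly_Mapping.lookup_add lookup_single in_keys_iff when_def\<close>)
  then show ?case using assms(2)[OF update(3)] by simp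
qed

text \<open>Both sides are additive in each factor, so induction on \<open>p\<close> and then on
  \<open>q\<close> reduces the claim to single terms.\<close>

lemma mpoly_subst_mult: "mpoly_subst f (p * q) = mpoly_subst f p * mpoly_subst f q"
proof (induction p rule: mpoly_induct)
  case (single_add p m c)
  have "mpoly_subst f (Poly_Mapping.single m c * q) = mpoly_subst f (Poly_Mapping.single m c) * mpoly_subst f q"
    by (induction q rule: mpoly_induct)
      (simp_all add: distrib_left mpoly_subst_add mult_single mpoly_subst_single monom_subst_add MConst_mult ac_simps)
  then show ?case using single_add by (simp add: distrib_right mpoly_subst_add)
qed simp

lemma mpoly_subst_MConst [simp]: "mpoly_subst f (MConst c) = MConst c"
  using mpoly_subst_single[of f 0 c] by (simp add: MConst_def monom_subst_def)

lemma mpoly_subst_MVar [simp]: "mpoly_subst f (MVar x) = f x"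
  using mpoly_subst_single[of f "Poly_Mapping.single x 1" 1]
  by (simp add: MVar_def monom_subst_def MConst_1)

lemma comm_ring_hom_mpoly_subst: "comm_ring_hom (mpoly_subst f)"
  by unfold_locales
    (use mpoly_subst_MConst[of f 1] in \<open>simp_all add: mpoly_subst_add mpoly_subst_mult MConst_1\<close>)

lemma mpoly_subst_poly_ring:
  assumes "\<And>x. x \<in> W \<Longrightarrow> f x \<in> carrier (poly_ring W')"
  shows "mpoly_subst f ` carrier (poly_ring W) \<subseteq> carrier (poly_ring W')"
proof -
  have "f x \<in> carrier (poly_ring W')"
    if "p \<in> carrier (poly_ring W)" "m \<in> Poly_Mapping.keys p" "x \<in> Poly_Mapping.keys m" for p m x
    using that assms by (auto simp: mem_poly_ring[of _ W])
  then show ?thesis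
    by (auto simp: mpoly_subst_def intro!: poly_ring_sum poly_ring_mult poly_ring_prod poly_ring_power)
qed

section \<open>Critical ideals\<close>

text \<open>Determinants live in the full polynomial type; row expansion shows inductively that no
  variables beyond those of the entries appear.\<close>

lemma minor_in_poly_ring:
  assumes "\<And>u w. u \<in> set rs \<Longrightarrow> w \<in> set cs \<Longrightarrow> K u w \<in> carrier (poly_ring W)" "length rs = length cs"
  shows "minor K rs cs \<in> carrier (poly_ring W)"
  using assms
proof (induction "length rs" arbitrary: rs cs)
  case 0
  then show ?case by simp
next
  case (Suc n)
  have "K (rs ! 0) (cs ! q) * ((-1) ^ (0 + q) * minor K (remove_nth 0 rs) (remove_nth q cs)) \<in> carrier (poly_ring W)"
    if "q < length cs" for q
  proof -
    have len: "length (remove_nth 0 rs) = n" "length (remove_nth q cs) = n"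
      using that Suc.hyps(2) Suc.prems(2) length_remove_nth[of 0 rs] length_remove_nth[of q cs] by linarith+
    have "minor K (remove_nth 0 rs) (remove_nth q cs) \<in> carrier (poly_ring W)"
    proof (rule Suc.hyps(1))
      fix u w assume "u \<in> set (remove_nth 0 rs)" "w \<in> set (remove_nth q cs)"
      then show "K u w \<in> carrier (poly_ring W)"
        using set_remove_nth[of 0 rs] set_remove_nth[of q cs] by (intro Suc.prems) blast+
    qed (simp_all add: len)
    moreover have "K (rs ! 0) (cs ! q) \<in> carrier (poly_ring W)"
      by (rule Suc.prems(1)[OF nth_mem nth_mem]) (use Suc.hyps(2) that in linarith)+
    ultimately show ?thesis by (intro poly_ring_mult poly_ring_power poly_ring_uminus poly_ring_1)
  qed
  then show ?case using Suc by (subst minor_row_expansion[of _ _ 0]) auto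
qed

definition minors :: "'u set \<Rightarrow> nat \<Rightarrow> ('u \<Rightarrow> 'u \<Rightarrow> 'r::comm_ring_1) \<Rightarrow> 'r set" where
  "minors V i K = {minor K rs cs | rs cs. distinct rs \<and> set rs \<subseteq> V \<and> length rs = i \<and>
     distinct cs \<and> set cs \<subseteq> V \<and> length cs = i}"

lemma minorsI:
  "distinct rs \<Longrightarrow> set rs \<subseteq> V \<Longrightarrow> length rs = i \<Longrightarrow> distinct cs \<Longrightarrow> set cs \<subseteq> V \<Longrightarrow> length cs = i \<Longrightarrow>
    minor K rs cs \<in> minors V i K"
  by (auto simp: minors_def)

lemma minorsE:
  assumes "x \<in> minors V i K"
  obtains rs cs where "x = minor K rs cs" "distinct rs" "set rs \<subseteq> V" "length rs = i"
    "distinct cs" "set cs \<subseteq> V" "length cs = i"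
  using assms by (auto simp: minors_def)

lemma setcompr_cong:
  "(\<And>a b. Q a b \<Longrightarrow> f a b = g a b) \<Longrightarrow> {f a b | a b. Q a b} = {g a b | a b. Q a b}"
  by metis

lemma minors_cong:
  assumes "\<And>u w. u \<in> V \<Longrightarrow> w \<in> V \<Longrightarrow> K u w = K' u w"
  shows "minors V i K = minors V i K'"
proof -
  have "minor K rs cs = minor K' rs cs" if "set rs \<subseteq> V" "set cs \<subseteq> V" "length rs = length cs" for rs cs
    by (rule minor_cong) (use that assms in auto)
  then show ?thesis unfolding minors_def by (intro setcompr_cong) auto
qed

lemma minors_hom:
  assumes "comm_ring_hom h"
  shows "h ` minors V i K = minors V i (\<lambda>u w. h (K u w))"
proof -
  have "h ` minors V i K = {h (minor K rs cs) | rs cs. distinct rs \<and> set rs \<subseteq> V \<and> length rs = i \<and>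
     distinct cs \<and> set cs \<subseteq> V \<and> length cs = i}"
    unfolding minors_def by blast
  then show ?thesis by (simp only: comm_ring_hom.minor_hom[OF assms] minors_def)
qed

lemma minors_in_poly_ring:
  assumes "\<And>u w. u \<in> V \<Longrightarrow> w \<in> V \<Longrightarrow> K u w \<in> carrier (poly_ring W)"
  shows "minors V i K \<subseteq> carrier (poly_ring W)"
  using assms by (fastforce elim!: minorsE intro!: minor_in_poly_ring)

text \<open>Expand along the row of \<open>v\<close>, so that the cofactors avoid it. Separate sets
  \<open>V\<close> and \<open>V'\<close> allow the column version to be applied after a row has been
  excluded.\<close>

lemma minors_Suc_delete_row:
  assumes "\<And>u w. u \<in> V \<Longrightarrow> w \<in> V' \<Longrightarrow> K u w \<in> carrier (poly_ring W)" "ideal I (poly_ring W)"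
    and I: "\<And>rs cs. distinct rs \<Longrightarrow> set rs \<subseteq> V - {v} \<Longrightarrow> length rs = i \<Longrightarrow>
      distinct cs \<Longrightarrow> set cs \<subseteq> V' \<Longrightarrow> length cs = i \<Longrightarrow> minor K rs cs \<in> I"
    and rs: "distinct rs" "set rs \<subseteq> V" "length rs = Suc i"
    and cs: "distinct cs" "set cs \<subseteq> V'" "length cs = Suc i"
  shows "minor K rs cs \<in> I"
proof -
  \<comment> \<open>If \<open>v\<close> is not a row, any row will do: the list has
    \<open>Suc i\<close> entries, hence is nonempty.\<close>
  obtain p where p: "p < length rs" "v \<in> set rs \<Longrightarrow> rs ! p = v"
    using rs(3) by (cases "v \<in> set rs") (auto simp: in_set_conv_nth)
  have "K (rs ! p) (cs ! q) * ((-1) ^ (p + q) * minor K (remove_nth p rs) (remove_nth q cs)) \<in> I"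
    if q: "q < length cs" for q
  proof -
    have "v \<notin> set (remove_nth p rs)"
      using p nth_notin_remove_nth[OF rs(1) p(1)] set_remove_nth[of p rs] by blast
    then have "minor K (remove_nth p rs) (remove_nth q cs) \<in> I"
      using rs cs p q set_remove_nth[of p rs] set_remove_nth[of q cs]
      by (intro I) (auto simp: distinct_remove_nth length_remove_nth)
    moreover have "K (rs ! p) (cs ! q) \<in> carrier (poly_ring W)"
      by (rule assms(1)) (use rs cs p q nth_mem in blast)+
    ultimately show ?thesis
      by (intro ideal_poly_ring_mult[OF assms(2)] poly_ring_power poly_ring_uminus poly_ring_1)
  qed
  then have "(\<Sum>q<length cs. K (rs ! p) (cs ! q) *
      ((-1) ^ (p + q) * minor K (remove_nth p rs) (remove_nth q cs))) \<in> I"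
    by (intro ideal_poly_ring_sum[OF assms(2)]) simp
  then show ?thesis using minor_row_expansion[of rs cs p K] rs cs p by simp
qed

lemma minors_Suc_delete_col:
  assumes "\<And>u w. u \<in> V \<Longrightarrow> w \<in> V' \<Longrightarrow> K u w \<in> carrier (poly_ring W)" "ideal I (poly_ring W)"
    and I: "\<And>rs cs. distinct rs \<Longrightarrow> set rs \<subseteq> V \<Longrightarrow> length rs = i \<Longrightarrow>
      distinct cs \<Longrightarrow> set cs \<subseteq> V' - {v} \<Longrightarrow> length cs = i \<Longrightarrow> minor K rs cs \<in> I"
    and rs: "distinct rs" "set rs \<subseteq> V" "length rs = Suc i"
    and cs: "distinct cs" "set cs \<subseteq> V'" "length cs = Suc i"
  shows "minor K rs cs \<in> I"
proof -
  have t: "minor K rs cs = minor (\<lambda>u w. K w u) cs rs" if "length rs = length cs" for rs cs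
    by (rule minor_transpose[OF that])
  have "minor (\<lambda>u w. K w u) cs rs \<in> I"
  proof (rule minors_Suc_delete_row[of V' V _ W I v i])
    fix rs cs assume "distinct rs" "set rs \<subseteq> V' - {v}" "length rs = i" "distinct cs" "set cs \<subseteq> V" "length cs = i"
    then show "minor (\<lambda>u w. K w u) rs cs \<in> I" using I[of cs rs] t[of cs rs] by simp
  qed (use assms in auto)
  then show ?thesis using t rs cs by simp
qed

lemma minors_add_2_subset:
  assumes "\<And>u w. u \<in> V \<Longrightarrow> w \<in> V \<Longrightarrow> K u w \<in> carrier (poly_ring W)" "ideal I (poly_ring W)"
    and I: "minors (V - {v}) i K \<subseteq> I"
  shows "minors V (i + 2) K \<subseteq> I"
proof
  fix x assume "x \<in> minors V (i + 2) K"
  then obtain rs cs where x: "x = minor K rs cs" "distinct rs" "set rs \<subseteq> V" "length rs = Suc (Suc i)"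
    "distinct cs" "set cs \<subseteq> V" "length cs = Suc (Suc i)"
    by (auto elim: minorsE)
  show "x \<in> I" unfolding x(1)
  proof (rule minors_Suc_delete_row[OF assms(1,2) _ x(2-)])
    fix rs cs assume *: "distinct rs" "set rs \<subseteq> V - {v}" "length rs = Suc i"
      "distinct cs" "set cs \<subseteq> V" "length cs = Suc i"
    show "minor K rs cs \<in> I"
    proof (rule minors_Suc_delete_col[OF _ assms(2) _ *])
      fix rs cs assume "distinct rs" "set rs \<subseteq> V - {v}" "length rs = i"
        "distinct cs" "set cs \<subseteq> V - {v}" "length cs = i"
      then show "minor K rs cs \<in> I" using I minorsI[of rs "V - {v}" i cs K] by blast
    qed (use assms(1) in auto)
  qed auto
qed

section \<open>Critical ideals and the algebraic co-rank\<close>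

lemma laplacian_minors_eq: "laplacian_minors G sg i = minors (verts G) i (gen_laplacian G sg)"
proof -
  have "det (mat i i (\<lambda>(a, b). gen_laplacian G sg (rs ! a) (cs ! b))) = minor (gen_laplacian G sg) rs cs"
    if "length rs = i" for rs cs
    using that by (auto simp: minor_def)
  then show ?thesis unfolding laplacian_minors_def minors_def by (intro setcompr_cong) auto
qed

lemma critical_ideal_eq:
  "critical_ideal G sg i = Idl\<^bsub>poly_ring (verts G)\<^esub> (minors (verts G) i (gen_laplacian G sg))"
  by (simp add: critical_ideal_def laplacian_minors_eq)

lemma gen_laplacian_in_poly_ring: "u \<in> W \<Longrightarrow> gen_laplacian G sg u w \<in> carrier (poly_ring W)"
  by (cases "u = w") (simp_all add: gen_laplacian_def)

lemma laplacian_minors_in_poly_ring: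
  "minors (verts G) i (gen_laplacian G sg) \<subseteq> carrier (poly_ring (verts G))"
  by (rule minors_in_poly_ring) (rule gen_laplacian_in_poly_ring)

lemma minors_empty:
  assumes "finite V" "card V < i"
  shows "minors V i K = {}"
proof -
  have "length rs \<le> card V" if "distinct rs" "set rs \<subseteq> V" for rs
    using that assms(1) by (metis card_mono distinct_card)
  then show ?thesis using assms(2) by (fastforce simp: minors_def)
qed

text \<open>The maximum exists: the empty minor makes size 0 admissible, while beyond the number of
  vertices there are no minors and the ideal is zero. Unlike a general maximality statement, nothing
  is claimed about the sizes below the maximum.\<close>

lemma alg_corank_aux:
  fixes P :: "'a::comm_ring_1 itself" and G :: "('v, 'e) pre_digraph"
  assumes "finite (verts G)"
  shows one_in_critical_ideal_corank: "(1 :: ('v, 'a) mpoly) \<in> critical_ideal G sg (alg_corank P G sg)"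
    and le_alg_corank: "\<And>i. (1 :: ('v, 'a) mpoly) \<in> critical_ideal G sg i \<Longrightarrow> i \<le> alg_corank P G sg"
proof -
  let ?Q = "\<lambda>i. (1 :: ('v, 'a) mpoly) \<in> critical_ideal G sg i"
  have "ideal (critical_ideal G sg i :: ('v, 'a) mpoly set) (poly_ring (verts G))" for i
    unfolding critical_ideal_eq by (rule ideal_Idl[OF laplacian_minors_in_poly_ring])
  then have eq: "alg_corank P G sg = (GREATEST i. ?Q i)"
    by (simp add: alg_corank_def ideal_eq_Idl_1_iff)
  have bound: "i \<le> card (verts G)" if "?Q i" for i
  proof (rule ccontr)
    assume "\<not> i \<le> card (verts G)"
    then have m: "minors (verts G) i (gen_laplacian G sg :: _ \<Rightarrow> _ \<Rightarrow> ('v, 'a) mpoly) = {}"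
      by (intro minors_empty assms) simp
    have "x = 0" if "x \<in> Idl\<^bsub>poly_ring (verts G)\<^esub> {}" for x :: "('v, 'a) mpoly"
      using that empty_subsetI by (induction rule: Idl_induct) auto
    from this[of 1] that show False unfolding critical_ideal_eq m by simp
  qed
  have "minor (gen_laplacian G sg :: _ \<Rightarrow> _ \<Rightarrow> ('v, 'a) mpoly) [] [] \<in> minors (verts G) 0 (gen_laplacian G sg)"
    by (rule minorsI) auto
  then have "?Q 0" unfolding critical_ideal_eq
    using Idl_superset[OF laplacian_minors_in_poly_ring] by fastforce
  then show "?Q (alg_corank P G sg)" unfolding eq by (rule GreatestI_nat) (rule bound)
  show "i \<le> alg_corank P G sg" if "?Q i" for i
    unfolding eq using that by (rule Greatest_le_nat) (rule bound)
qed

lemma Idl_mono_ring: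
  assumes "W \<subseteq> W'" "S \<subseteq> S'" "S \<subseteq> carrier (poly_ring W)" "S' \<subseteq> carrier (poly_ring W')"
  shows "Idl\<^bsub>poly_ring W\<^esub> S \<subseteq> Idl\<^bsub>poly_ring W'\<^esub> S'"
proof
  note I = ideal_Idl[OF assms(4)]
  fix x assume "x \<in> Idl\<^bsub>poly_ring W\<^esub> S"
  then show "x \<in> Idl\<^bsub>poly_ring W'\<^esub> S'" using assms(3)
  proof (induction rule: Idl_induct)
    case (gen s)
    then show ?case using Idl_superset[OF assms(4)] assms(2) by auto
  next
    case (mult a b)
    then have "a \<in> carrier (poly_ring W')" using assms(1) unfolding mem_poly_ring by blast
    then show ?case using mult(2) by (rule ideal_poly_ring_mult[OF I])
  qed (auto intro: ideal_poly_ring_0[OF I] ideal_poly_ring_add[OF I])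
qed

text \<open>The element 0 is allowed among the images because specializing variables may send a
  minor to one with repeated rows or columns.\<close>

lemma one_in_Idl_hom:
  assumes "comm_ring_hom h" "h ` carrier (poly_ring W) \<subseteq> carrier (poly_ring W')"
    and S: "S \<subseteq> carrier (poly_ring W)" and S': "S' \<subseteq> carrier (poly_ring W')"
    and "h ` S \<subseteq> insert 0 S'" "1 \<in> Idl\<^bsub>poly_ring W\<^esub> S"
  shows "1 \<in> Idl\<^bsub>poly_ring W'\<^esub> S'"
proof -
  interpret comm_ring_hom h by fact
  have "h 1 \<in> Idl\<^bsub>poly_ring W'\<^esub> (h ` S)"
    by (rule subsetD[OF Idl_hom_image[OF assms(1-3)] imageI[OF assms(6)]])
  also have "\<dots> \<subseteq> Idl\<^bsub>poly_ring W'\<^esub> S'"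
  proof (rule Idl_least)
    show "h ` S \<subseteq> carrier (poly_ring W')" using assms(2) S by blast
    show "h ` S \<subseteq> Idl\<^bsub>poly_ring W'\<^esub> S'"
      using assms(5)
    proof (rule order_trans)
      show "insert 0 S' \<subseteq> Idl\<^bsub>poly_ring W'\<^esub> S'"
        using Idl_superset[OF S'] ideal_poly_ring_0[OF ideal_Idl[OF S']] by simp
    qed
  qed (rule ideal_Idl[OF S'])
  finally show ?thesis by simp
qed

text \<open>Parallel arcs share their sign, so the arbitrary choice in \<open>arc_sign\<close> is
  harmless.\<close>

lemma (in signed_multidigraph) arc_sign_eq:
  assumes "e \<in> arcs_from_to G u w" "u \<noteq> w"
  shows "arc_sign G sg u w = sg e"
proof -
  have some: "(SOME e. e \<in> arcs_from_to G u w) \<in> arcs_from_to G u w" using assms(1) by (rule someI)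
  show ?thesis unfolding arc_sign_def
    by (rule sign_parallel) (use assms some in \<open>auto simp: arcs_from_to_def arc_to_ends_def\<close>)
qed

lemma MConst_uminus: "MConst (- a) = - MConst a"
  by (simp add: MConst_def single_uminus)

section \<open>The Laplacian of a replicated graph as a blowup\<close>

locale replicated_vertex = signed_multidigraph G sg
  for G :: "('v, 'e) pre_digraph" and sg :: "'e \<Rightarrow> int" +
  fixes v :: 'v and P :: "'a::comm_ring_1 itself"
  assumes v_in_verts: "v \<in> verts G"
begin

abbreviation H :: "nat \<Rightarrow> ('v \<times> nat, 'e \<times> nat + nat \<times> nat) pre_digraph" where
  "H n \<equiv> replicate_vert G v n"

abbreviation LH :: "nat \<Rightarrow> 'v \<times> nat \<Rightarrow> 'v \<times> nat \<Rightarrow> ('v \<times> nat, 'a) mpoly" where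
  "LH n \<equiv> gen_laplacian (H n) (replicate_sign sg)"

abbreviation \<sigma> :: "'v \<Rightarrow> ('v \<times> nat, 'a) mpoly" where
  "\<sigma> u \<equiv> (if u = v then -1 else MVar (u, 0))"

text \<open>The value -1 is the Laplacian entry between two different copies, so at this value the
  rows of all copies of \<open>v\<close> agree. The variables already bear the names used in the
  replicated graph.\<close>

definition A :: "'v \<Rightarrow> 'v \<Rightarrow> ('v \<times> nat, 'a) mpoly" where
  "A u w = mpoly_subst \<sigma> (gen_laplacian G sg u w)"

definition D :: "nat \<Rightarrow> 'v \<times> nat \<Rightarrow> ('v \<times> nat, 'a) mpoly" where
  "D n c = (if c \<in> {v} \<times> {0..n} then MVar c + 1 else 0)"

text \<open>The variables that \<open>A\<close> really involves. They do not depend on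
  \<open>n\<close>, so unit ideals can be compared across different replications.\<close>

abbreviation W0 :: "('v \<times> nat) set" where
  "W0 \<equiv> (verts G - {v}) \<times> {0}"

lemma verts_H: "verts (H n) = W0 \<union> {v} \<times> {0..n}"
  by (simp add: replicate_vert_def)

lemma finite_verts_H: "finite (verts (H n))"
  by (simp add: verts_H)

lemma A_diag: "A u u = \<sigma> u"
  by (simp add: A_def gen_laplacian_def)

lemma A_off_diag: "u \<noteq> w \<Longrightarrow> A u w = MConst (- (of_int (arc_sign G sg u w) * of_nat (arc_mult G u w)))"
  by (simp add: A_def gen_laplacian_def)

lemma A_in_poly_ring: "u \<in> verts G \<Longrightarrow> A u w \<in> carrier (poly_ring W0)"
  by (cases "u = w") (auto simp: A_diag A_off_diag)

lemma A_in_poly_ring_H: "u \<in> verts G \<Longrightarrow> A u w \<in> carrier (poly_ring (verts (H n)))"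
  by (cases "u = w") (auto simp: A_diag A_off_diag verts_H)

lemma minors_A_in_poly_ring: "V \<subseteq> verts G \<Longrightarrow> minors V i A \<subseteq> carrier (poly_ring W0)"
  by (rule minors_in_poly_ring) (auto intro: A_in_poly_ring)

lemma minors_A_in_poly_ring_H: "V \<subseteq> verts G \<Longrightarrow> minors V i A \<subseteq> carrier (poly_ring (verts (H n)))"
  by (rule minors_in_poly_ring) (auto intro: A_in_poly_ring_H)

text \<open>At most one of \<open>u\<close> and \<open>w\<close> is \<open>v\<close>, and the other
  one has index 0; hence \<open>i + j\<close> is the index of the copy involved.\<close>

lemma arcs_from_to_H:
  assumes "(u, i) \<in> verts (H n)" "(w, j) \<in> verts (H n)" "u \<noteq> w"
  shows "arcs_from_to (H n) (u, i) (w, j) = (\<lambda>e. Inl (e, i + j)) ` arcs_from_to G u w"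
  using assms
  by (auto simp: arcs_from_to_def arc_to_ends_def replicate_vert_def split: if_splits)

lemma arcs_from_to_H_copies:
  assumes "i \<le> n" "j \<le> n" "i \<noteq> j"
  shows "arcs_from_to (H n) (v, i) (v, j) = {Inr (i, j)}"
  using assms
  by (auto simp: arcs_from_to_def arc_to_ends_def replicate_vert_def split: if_splits)

text \<open>On the diagonal of a copy, x = -1 + (x + 1); between two copies the single positive arc
  gives -1, which is \<open>A v v\<close>; between different originals the arcs correspond one to
  one with equal signs.\<close>

lemma LH_eq_blowup:
  assumes "x \<in> verts (H n)" "z \<in> verts (H n)"
  shows "LH n x z = blowup fst A (D n) x z"
proof -
  obtain u i w j where xz: "x = (u, i)" "z = (w, j)" by (cases x, cases z)
  consider "x = z" | "x \<noteq> z" "u = w" | "u \<noteq> w" by blast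
  then show ?thesis
  proof cases
    case 1
    then show ?thesis using assms
      by (auto simp: gen_laplacian_def blowup_def A_diag D_def xz verts_H)
  next
    case 2
    then have *: "u = v" "i \<le> n" "j \<le> n" "i \<noteq> j" using assms by (auto simp: xz verts_H)
    then have arcs: "arcs_from_to (H n) x z = {Inr (i, j)}" using 2 xz by (simp add: arcs_from_to_H_copies)
    have "arc_sign (H n) (replicate_sign sg) x z = 1" "arc_mult (H n) x z = 1"
      unfolding arc_sign_def arc_mult_def arcs by (simp_all add: replicate_sign_def)
    moreover have "x = (v, i)" "z = (v, j)" using * 2 xz by simp_all
    ultimately show ?thesis using *(4)
      by (simp add: gen_laplacian_def blowup_def A_diag MConst_uminus MConst_1)
  next
    case 3
    then have arcs: "arcs_from_to (H n) x z = (\<lambda>e. Inl (e, i + j)) ` arcs_from_to G u w"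
      using assms xz by (simp add: arcs_from_to_H)
    have mult: "arc_mult (H n) x z = arc_mult G u w"
      unfolding arc_mult_def arcs by (rule card_image) (auto simp: inj_on_def)
    have "arc_sign (H n) (replicate_sign sg) x z = arc_sign G sg u w" if "arcs_from_to G u w \<noteq> {}"
    proof -
      from that obtain e0 where "e0 \<in> arcs_from_to G u w" by blast
      then have "Inl (e0, i + j) \<in> arcs_from_to (H n) x z" by (simp add: arcs)
      then have "(SOME a. a \<in> arcs_from_to (H n) x z) \<in> arcs_from_to (H n) x z" by (rule someI)
      then obtain e where "e \<in> arcs_from_to G u w" "(SOME a. a \<in> arcs_from_to (H n) x z) = Inl (e, i + j)"
        unfolding arcs by auto
      then show ?thesis using arc_sign_eq[OF _ 3] by (simp add: arc_sign_def[of "H n"] replicate_sign_def)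
    qed
    \<comment> \<open>Without arcs both signs are unspecified values, but the multiplicity 0 cancels
      them.\<close>
    moreover have "arc_mult G u w = 0" if "arcs_from_to G u w = {}" using that by (simp add: arc_mult_def)
    ultimately show ?thesis using 3 mult xz
      by (cases "arcs_from_to G u w = {}") (simp_all add: gen_laplacian_def blowup_def A_off_diag)
  qed
qed

lemma minors_LH: "minors (verts (H n)) i (LH n) = minors (verts (H n)) i (blowup fst A (D n))"
  by (rule minors_cong) (rule LH_eq_blowup)

lemma critical_ideal_H:
  "critical_ideal (H n) (replicate_sign sg) i = Idl\<^bsub>poly_ring (verts (H n))\<^esub> (minors (verts (H n)) i (blowup fst A (D n)))"
  by (simp only: critical_ideal_eq minors_LH)

lemma minors_H_in_poly_ring:
  "minors (verts (H n)) i (blowup fst A (D n)) \<subseteq> carrier (poly_ring (verts (H n)))"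
  unfolding minors_LH[symmetric] by (rule laplacian_minors_in_poly_ring)

lemma ideal_at_minus_one_eq:
  "ideal_at_minus_one (verts (H n)) v (critical_ideal G sg i) = Idl\<^bsub>poly_ring (verts (H n))\<^esub> (minors (verts G) i A)"
proof -
  have "Idl\<^bsub>poly_ring (verts (H n))\<^esub> (mpoly_subst \<sigma> ` (Idl\<^bsub>poly_ring (verts G)\<^esub> (minors (verts G) i (gen_laplacian G sg))))
      = Idl\<^bsub>poly_ring (verts (H n))\<^esub> (mpoly_subst \<sigma> ` minors (verts G) i (gen_laplacian G sg))"
    by (intro Idl_hom_image_Idl comm_ring_hom_mpoly_subst mpoly_subst_poly_ring laplacian_minors_in_poly_ring)
      (auto simp: verts_H)
  then show ?thesis
    by (simp add: ideal_at_minus_one_def critical_ideal_eq minors_hom[OF comm_ring_hom_mpoly_subst] A_def[abs_def])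
qed

section \<open>Co-ranks expressed by minors of \<open>A\<close>\<close>

lemma gen_laplacian_del_vert:
  assumes "u \<noteq> v" "w \<noteq> v"
  shows "gen_laplacian (del_vert v) sg u w = gen_laplacian G sg u w"
proof -
  have "arcs_from_to (del_vert v) u w = arcs_from_to G u w"
    using assms by (auto simp: arcs_from_to_def arc_to_ends_def del_vert_simps)
  then show ?thesis by (simp add: gen_laplacian_def arc_sign_def arc_mult_def)
qed

lemma critical_ideal_del_vert:
  "critical_ideal (del_vert v) sg i = Idl\<^bsub>poly_ring (verts G - {v})\<^esub> (minors (verts G - {v}) i (gen_laplacian G sg))"
  unfolding critical_ideal_eq verts_del_vert by (subst minors_cong[OF gen_laplacian_del_vert]) auto

text \<open>Away from \<open>v\<close>, \<open>A\<close> is the Laplacian of G - v with renamed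
  variables. Renaming in either direction maps minors to minors, so the co-rank of G - v can be read
  off \<open>A\<close>.\<close>

lemma one_in_critical_ideal_del_vert_iff:
  "(1 :: ('v, 'a) mpoly) \<in> critical_ideal (del_vert v) sg i \<longleftrightarrow>
    (1 :: ('v \<times> nat, 'a) mpoly) \<in> Idl\<^bsub>poly_ring W0\<^esub> (minors (verts G - {v}) i A)"
proof -
  have L: "minors (verts G - {v}) i (gen_laplacian G sg) \<subseteq> carrier (poly_ring (verts G - {v}) :: ('v, 'a) mpoly ring)"
    by (rule minors_in_poly_ring) (auto intro: gen_laplacian_in_poly_ring)
  have A: "minors (verts G - {v}) i A \<subseteq> carrier (poly_ring W0 :: ('v \<times> nat, 'a) mpoly ring)"
    by (rule minors_A_in_poly_ring) auto
  show ?thesis unfolding critical_ideal_del_vert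
  proof
    assume "(1 :: ('v, 'a) mpoly) \<in> Idl\<^bsub>poly_ring (verts G - {v})\<^esub> (minors (verts G - {v}) i (gen_laplacian G sg))"
    then show "(1 :: ('v \<times> nat, 'a) mpoly) \<in> Idl\<^bsub>poly_ring W0\<^esub> (minors (verts G - {v}) i A)"
    proof (rule one_in_Idl_hom[OF comm_ring_hom_mpoly_subst _ L A, rotated 2])
      show "mpoly_subst \<sigma> ` carrier (poly_ring (verts G - {v})) \<subseteq> (carrier (poly_ring W0) :: ('v \<times> nat, 'a) mpoly set)"
        by (rule mpoly_subst_poly_ring) auto
      show "mpoly_subst \<sigma> ` minors (verts G - {v}) i (gen_laplacian G sg) \<subseteq> insert (0 :: ('v \<times> nat, 'a) mpoly) (minors (verts G - {v}) i A)"
        unfolding minors_hom[OF comm_ring_hom_mpoly_subst] A_def[abs_def] by blast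
    qed
  next
    let ?h = "mpoly_subst (\<lambda>x. MVar (fst x)) :: ('v \<times> nat, 'a) mpoly \<Rightarrow> ('v, 'a) mpoly"
    assume "(1 :: ('v \<times> nat, 'a) mpoly) \<in> Idl\<^bsub>poly_ring W0\<^esub> (minors (verts G - {v}) i A)"
    then show "(1 :: ('v, 'a) mpoly) \<in> Idl\<^bsub>poly_ring (verts G - {v})\<^esub> (minors (verts G - {v}) i (gen_laplacian G sg))"
    proof (rule one_in_Idl_hom[OF comm_ring_hom_mpoly_subst _ A L, rotated 2])
      show "?h ` carrier (poly_ring W0) \<subseteq> carrier (poly_ring (verts G - {v}))"
        by (rule mpoly_subst_poly_ring) (auto intro!: MVar_in_poly_ring)
      have "?h (A u w) = gen_laplacian G sg u w" if "u \<in> verts G - {v}" "w \<in> verts G - {v}" for u w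
        using that by (cases "u = w") (auto simp: A_diag A_off_diag gen_laplacian_def)
      then have "minors (verts G - {v}) i (\<lambda>u w. ?h (A u w)) = minors (verts G - {v}) i (gen_laplacian G sg)"
        by (rule minors_cong)
      then show "?h ` minors (verts G - {v}) i A \<subseteq> insert 0 (minors (verts G - {v}) i (gen_laplacian G sg))"
        unfolding minors_hom[OF comm_ring_hom_mpoly_subst] by blast
    qed
  qed
qed

text \<open>Setting all copies of the variable of \<open>v\<close> to \<open>-1\<close> kills the diagonal part of the blowup.\<close>

lemma one_in_Idl_minors_A:
  assumes "(1 :: ('v \<times> nat, 'a) mpoly) \<in> critical_ideal (H n) (replicate_sign sg) i"
  shows "(1 :: ('v \<times> nat, 'a) mpoly) \<in> Idl\<^bsub>poly_ring W0\<^esub> (minors (verts G) i A)"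
proof -
  let ?h = "mpoly_subst (\<lambda>x. \<sigma> (fst x)) :: ('v \<times> nat, 'a) mpoly \<Rightarrow> ('v \<times> nat, 'a) mpoly"
  note hom = comm_ring_hom_mpoly_subst[of "\<lambda>x :: 'v \<times> nat. \<sigma> (fst x) :: ('v \<times> nat, 'a) mpoly"]
  interpret h: comm_ring_hom ?h by (rule hom)
  \<comment> \<open>The only variables in \<open>A\<close> are those of vertices other than
    \<open>v\<close>, which \<open>?h\<close> fixes.\<close>
  have hA: "?h (A u w) = A u w" for u w
    by (cases "u = w") (auto simp: A_diag A_off_diag h.hom_uminus)
  have hD: "?h (D n c) = 0" for c
    by (auto simp: D_def h.hom_add)
  have hB: "?h (blowup fst A (D n) x z) = A (fst x) (fst z)" for x z
    by (simp add: blowup_def h.hom_add hA hD)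
  show ?thesis
  proof (rule one_in_Idl_hom[OF hom _ minors_H_in_poly_ring minors_A_in_poly_ring])
    show "?h ` carrier (poly_ring (verts (H n))) \<subseteq> carrier (poly_ring W0)"
      by (rule mpoly_subst_poly_ring) (auto simp: verts_H poly_ring_uminus)
    show "?h ` minors (verts (H n)) i (blowup fst A (D n)) \<subseteq> insert 0 (minors (verts G) i A)"
    proof
      fix x assume "x \<in> ?h ` minors (verts (H n)) i (blowup fst A (D n))"
      then have "x \<in> minors (verts (H n)) i (\<lambda>x z. A (fst x) (fst z))"
        unfolding minors_hom[OF hom] hB .
      then obtain rs cs where x: "x = minor (\<lambda>x z. A (fst x) (fst z)) rs cs" and
        *: "set rs \<subseteq> verts (H n)" "length rs = i" "set cs \<subseteq> verts (H n)" "length cs = i"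
        by (auto elim: minorsE)
      have x': "x = minor A (map fst rs) (map fst cs)" unfolding x by (rule minor_map[symmetric]) (use * in simp)
      have **: "set (map fst rs) \<subseteq> verts G" "set (map fst cs) \<subseteq> verts G"
        using * v_in_verts by (auto simp: verts_H)
      show "x \<in> insert 0 (minors (verts G) i A)"
      proof (cases "distinct (map fst rs) \<and> distinct (map fst cs)")
        case True
        then have "x \<in> minors (verts G) i A"
          unfolding x' by (intro minorsI) (use * ** in auto)
        then show ?thesis by simp
      next
        case False
        then have "x = 0" unfolding x' by (intro minor_not_distinct) (use * in auto)
        then show ?thesis by simp
      qed
    qed
    show "1 \<in> Idl\<^bsub>poly_ring (verts (H n))\<^esub> (minors (verts (H n)) i (blowup fst A (D n)) :: ('v \<times> nat, 'a) mpoly set)"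
      using assms unfolding critical_ideal_H .
  qed auto
qed

text \<open>A minor avoiding \<open>v\<close> meets no diagonal term, so it is itself a minor of the
  blowup. This shows that the co-rank of G - v is at most that of a replication.\<close>

lemma one_in_critical_ideal_H:
  assumes "(1 :: ('v \<times> nat, 'a) mpoly) \<in> Idl\<^bsub>poly_ring W0\<^esub> (minors (verts G - {v}) i A)"
  shows "(1 :: ('v \<times> nat, 'a) mpoly) \<in> critical_ideal (H n) (replicate_sign sg) i"
proof -
  have "minors (verts G - {v}) i A \<subseteq> minors (verts (H n)) i (blowup fst A (D n))"
  proof
    fix x assume "x \<in> minors (verts G - {v}) i A"
    then obtain rs cs where x: "x = minor A rs cs" and
      *: "distinct rs" "set rs \<subseteq> verts G - {v}" "length rs = i" "distinct cs" "set cs \<subseteq> verts G - {v}" "length cs = i"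
      by (auto elim: minorsE)
    let ?f = "map (\<lambda>u. (u, 0)) :: 'v list \<Rightarrow> ('v \<times> nat) list"
    have "minor (blowup fst A (D n)) (?f rs) (?f cs) = minor A (map fst (?f rs)) (map fst (?f cs))"
      by (rule minor_blowup_const) (use * in \<open>auto simp: D_def\<close>)
    then have x': "x = minor (blowup fst A (D n)) (?f rs) (?f cs)" by (simp add: x comp_def)
    show "x \<in> minors (verts (H n)) i (blowup fst A (D n))"
      unfolding x' by (rule minorsI) (use * in \<open>auto simp: verts_H distinct_map inj_on_def\<close>)
  qed
  then have "Idl\<^bsub>poly_ring W0\<^esub> (minors (verts G - {v}) i A) \<subseteq> critical_ideal (H n) (replicate_sign sg) i"
    unfolding critical_ideal_H
    by (intro Idl_mono_ring minors_A_in_poly_ring minors_H_in_poly_ring) (auto simp: verts_H)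
  then show ?thesis using assms by blast
qed

lemma one_in_Idl_minors_A_minus_2:
  assumes "1 \<in> Idl\<^bsub>poly_ring W0\<^esub> (minors (verts G) (i + 2) A)"
  shows "1 \<in> Idl\<^bsub>poly_ring W0\<^esub> (minors (verts G - {v}) i A)"
proof -
  have A: "minors (verts G - {v}) i A \<subseteq> carrier (poly_ring W0)"
    by (rule minors_A_in_poly_ring) auto
  have "Idl\<^bsub>poly_ring W0\<^esub> (minors (verts G) (i + 2) A) \<subseteq> Idl\<^bsub>poly_ring W0\<^esub> (minors (verts G - {v}) i A)"
    by (intro Idl_least minors_A_in_poly_ring ideal_Idl[OF A] subset_refl
        minors_add_2_subset[OF A_in_poly_ring _ Idl_superset[OF A]])
  then show ?thesis using assms by blast
qed

section \<open>The generators on the right-hand side, and the first inclusion\<close>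

text \<open>Indexing by the copies themselves identifies the factors with diagonal entries of the
  blowup.\<close>

lemma P_tilde_eq: "P_tilde v n l = {\<Prod>c\<in>C. D n c | C. C \<subseteq> {v} \<times> {0..n} \<and> card C = l}"
proof (intro equalityI subsetI)
  fix p :: "('v \<times> nat, 'a) mpoly" assume "p \<in> P_tilde v n l"
  then obtain C where C: "p = (\<Prod>c\<in>C. MVar (v, c) + 1)" "C \<subseteq> {0..n}" "card C = l"
    by (auto simp: P_tilde_def)
  have "p = (\<Prod>c\<in>Pair v ` C. D n c)"
    unfolding C(1) by (subst prod.reindex) (use C(2) in \<open>auto simp: inj_on_def D_def intro!: prod.cong\<close>)
  moreover have "Pair v ` C \<subseteq> {v} \<times> {0..n}" "card (Pair v ` C) = l"
    using C by (auto simp: card_image inj_on_def)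
  ultimately show "p \<in> {\<Prod>c\<in>C. D n c | C. C \<subseteq> {v} \<times> {0..n} \<and> card C = l}" by blast
next
  fix p :: "('v \<times> nat, 'a) mpoly"
  assume "p \<in> {\<Prod>c\<in>C. D n c | C. C \<subseteq> {v} \<times> {0..n} \<and> card C = l}"
  then obtain C where C: "p = (\<Prod>c\<in>C. D n c)" "C \<subseteq> {v} \<times> {0..n}" "card C = l" by auto
  have inj: "inj_on snd C" using C(2) by (auto simp: inj_on_def)
  have "(\<Prod>c\<in>snd ` C. MVar (v, c) + 1) = p"
    unfolding C(1) by (subst prod.reindex[OF inj]) (use C(2) in \<open>auto simp: D_def intro!: prod.cong\<close>)
  moreover have "snd ` C \<subseteq> {0..n}" "card (snd ` C) = l" using C inj by (auto simp: card_image)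
  ultimately show "p \<in> P_tilde v n l" unfolding P_tilde_def by blast
qed

lemma D_in_poly_ring [simp]: "D n c \<in> carrier (poly_ring (verts (H n)))"
  by (auto simp: D_def verts_H)

lemma set_mult_poly_ring: "S <#>\<^bsub>poly_ring W\<^esub> T = {s * t | s t. s \<in> S \<and> t \<in> T}"
  by (auto simp: set_mult_def)

text \<open>In the application \<open>g\<close> is the co-rank of r(G, v). Since \<open>l\<close>
  never exceeds \<open>k\<close>, the natural subtraction does not truncate.\<close>

definition mixed_products :: "nat \<Rightarrow> nat \<Rightarrow> nat \<Rightarrow> ('v \<times> nat, 'a) mpoly set" where
  "mixed_products n g k = (\<Union>l\<in>{0..k}. P_tilde v n l <#>\<^bsub>poly_ring (verts (H n))\<^esub>
     Idl\<^bsub>poly_ring (verts (H n))\<^esub> (minors (verts G) (g + k - l) A))"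

lemma mixed_productsI:
  "C \<subseteq> {v} \<times> {0..n} \<Longrightarrow> card C \<le> k \<Longrightarrow> z \<in> Idl\<^bsub>poly_ring (verts (H n))\<^esub> (minors (verts G) (g + k - card C) A) \<Longrightarrow>
    (\<Prod>c\<in>C. D n c) * z \<in> mixed_products n g k"
  unfolding mixed_products_def set_mult_poly_ring P_tilde_eq by fastforce

lemma mixed_productsE:
  assumes "x \<in> mixed_products n g k"
  obtains C z where "x = (\<Prod>c\<in>C. D n c) * z" "C \<subseteq> {v} \<times> {0..n}" "card C \<le> k"
    "z \<in> Idl\<^bsub>poly_ring (verts (H n))\<^esub> (minors (verts G) (g + k - card C) A)"
  using assms unfolding mixed_products_def set_mult_poly_ring P_tilde_eq by auto

lemma mixed_products_in_poly_ring: "mixed_products n g k \<subseteq> carrier (poly_ring (verts (H n)))"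
proof
  fix x assume "x \<in> mixed_products n g k"
  then show "x \<in> carrier (poly_ring (verts (H n)))"
    by (rule mixed_productsE)
      (use ideal_poly_ring_subset[OF ideal_Idl[OF minors_A_in_poly_ring_H[OF subset_refl]]]
        in \<open>auto intro!: poly_ring_mult poly_ring_prod\<close>)
qed

text \<open>Terms with more than \<open>k\<close> diagonal factors are multiples of terms with exactly \<open>k\<close> of them,
  because the minors of size \<open>g\<close> generate the unit ideal.\<close>

lemma critical_ideal_H_subset:
  assumes one: "(1 :: ('v \<times> nat, 'a) mpoly) \<in> Idl\<^bsub>poly_ring W0\<^esub> (minors (verts G) g A)"
  shows "critical_ideal (H n) (replicate_sign sg) (g + k) \<subseteq>
    Idl\<^bsub>poly_ring (verts (H n))\<^esub> (mixed_products n g k :: ('v \<times> nat, 'a) mpoly set)"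
    (is "_ \<subseteq> ?I")
proof -
  let ?R = "poly_ring (verts (H n)) :: ('v \<times> nat, 'a) mpoly ring"
  note I = ideal_Idl[OF mixed_products_in_poly_ring]
  have unit: "x \<in> Idl\<^bsub>?R\<^esub> (minors (verts G) g A)" if "x \<in> carrier ?R" for x
  proof -
    have "Idl\<^bsub>poly_ring W0\<^esub> (minors (verts G) g A) \<subseteq> Idl\<^bsub>?R\<^esub> (minors (verts G) g A)"
      by (intro Idl_mono_ring minors_A_in_poly_ring minors_A_in_poly_ring_H) (auto simp: verts_H)
    then show ?thesis
      using ideal_poly_ring_mult[OF ideal_Idl[OF minors_A_in_poly_ring_H[OF subset_refl]] that] one by fastforce
  qed
  have gen: "(\<Prod>c\<in>C. D n c) * m \<in> mixed_products n g k"
    if C: "C \<subseteq> {v} \<times> {0..n}" and m: "m \<in> minors (verts G) i A" "i + card C = g + k"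
    for C m i
  proof -
    have m': "m \<in> Idl\<^bsub>?R\<^esub> (minors (verts G) i A)" using m Idl_superset[OF minors_A_in_poly_ring_H[OF subset_refl]] by blast
    have mR: "m \<in> carrier ?R" using m minors_A_in_poly_ring_H[OF subset_refl] by blast
    show ?thesis
    proof (cases "card C \<le> k")
      case True
      have "i = g + k - card C" using m by simp
      then show ?thesis using C True m' by (intro mixed_productsI) auto
    next
      case False
      have fin: "finite C" using C by (rule finite_subset) simp
      \<comment> \<open>Keep only \<open>k\<close> factors; the remaining ones go into the cofactor,
        which lies in the ideal of the minors of size \<open>g\<close>, as every ring element
        does.\<close>
      obtain C' where C': "C' \<subseteq> C" "card C' = k" using False obtain_subset_with_card_n[of k C] by auto
      have "(\<Prod>c\<in>C. D n c) = (\<Prod>c\<in>C'. D n c) * (\<Prod>c\<in>C - C'. D n c :: ('v \<times> nat, 'a) mpoly)"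
        using prod.subset_diff[OF C'(1) fin, of "D n"] by (simp add: mult.commute)
      moreover have "(\<Prod>c\<in>C'. D n c) * ((\<Prod>c\<in>C - C'. D n c) * m) \<in> mixed_products n g k"
        using C C' mR by (intro mixed_productsI) (auto intro!: unit poly_ring_mult poly_ring_prod)
      ultimately show ?thesis by (simp add: mult.assoc)
    qed
  qed
  have "minors (verts (H n)) (g + k) (blowup fst A (D n)) \<subseteq> ?I"
  proof
    fix x assume "x \<in> minors (verts (H n)) (g + k) (blowup fst A (D n) :: _ \<Rightarrow> _ \<Rightarrow> ('v \<times> nat, 'a) mpoly)"
    then obtain rs cs where x: "x = minor (blowup fst A (D n)) rs cs" and
      *: "distinct rs" "set rs \<subseteq> verts (H n)" "length rs = g + k"
        "distinct cs" "set cs \<subseteq> verts (H n)" "length cs = g + k"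
      by (auto elim: minorsE)
    \<comment> \<open>The leading 1 is the initial value of the factor \<open>e\<close> collected in
      \<open>minor_blowup_mem\<close>.\<close>
    have "1 * minor (blowup fst A (\<lambda>u. if u \<in> {v} \<times> {0..n} then D n u else 0)) rs cs \<in> ?I"
    proof (rule minor_blowup_mem)
      fix C rs' cs'
      assume C: "C \<subseteq> {v} \<times> {0..n}" "length rs' + card C = length rs" and
        **: "distinct rs'" "distinct cs'" "set rs' \<subseteq> fst ` set rs" "set cs' \<subseteq> fst ` set cs" "length rs' = length cs'"
      have "fst ` verts (H n) \<subseteq> verts G" using v_in_verts by (auto simp: verts_H)
      then have "set rs' \<subseteq> verts G" "set cs' \<subseteq> verts G"
        using * **(3,4) by (meson image_mono order_trans)+
      then have "(minor A rs' cs' :: ('v \<times> nat, 'a) mpoly) \<in> minors (verts G) (length rs') A"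
        using ** by (intro minorsI) auto
      then have "(\<Prod>c\<in>C. D n c) * (minor A rs' cs' :: ('v \<times> nat, 'a) mpoly) \<in> mixed_products n g k"
        using C * by (intro gen) auto
      then show "1 * (\<Prod>c\<in>C. D n c) * minor A rs' cs' \<in> ?I"
        using Idl_superset[OF mixed_products_in_poly_ring] by auto
    qed (use * in \<open>auto intro: ideal_poly_ring_0[OF I] ideal_poly_ring_add[OF I] ideal_poly_ring_uminus[OF I]\<close>)
    moreover have "(\<lambda>u. if u \<in> {v} \<times> {0..n} then D n u else 0) = (D n :: _ \<Rightarrow> ('v \<times> nat, 'a) mpoly)"
      by (auto simp: D_def fun_eq_iff)
    ultimately show "x \<in> ?I" unfolding x by simp
  qed
  then show ?thesis unfolding critical_ideal_H by (intro Idl_least[OF minors_H_in_poly_ring I])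
qed

section \<open>The second inclusion: realizing products by minors\<close>

abbreviation lift :: "'v \<times> nat \<Rightarrow> 'v list \<Rightarrow> ('v \<times> nat) list" where
  "lift c \<equiv> map (\<lambda>u. if u = v then c else (u, 0))"

lemma map_fst_lift: "fst c = v \<Longrightarrow> map fst (lift c rs) = rs"
  by (auto simp: comp_def intro!: map_idI)

lemma distinct_lift: "fst c = v \<Longrightarrow> distinct rs \<Longrightarrow> distinct (lift c rs)"
  by (auto simp: distinct_map inj_on_def split: if_splits)

lemma set_lift: "c \<in> {v} \<times> {0..n} \<Longrightarrow> set rs \<subseteq> verts G \<Longrightarrow> set (lift c rs) \<subseteq> verts (H n)"
  by (auto simp: verts_H split: if_splits)

lemma in_set_lift: "fst e = v \<Longrightarrow> fst c = v \<Longrightarrow> e \<in> set (lift c rs) \<longleftrightarrow> e = c \<and> v \<in> set rs"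
  by (auto split: if_splits)

lemma D_not_copy: "fst e \<noteq> v \<Longrightarrow> D n e = 0"
  by (auto simp: D_def)

text \<open>A copy outside \<open>zs\<close> that stands for \<open>v\<close> on one side only
  serves as reference row or column, by which the copies in \<open>zs\<close> split off with their
  diagonal entries. What remains meets no diagonal term and is a minor of \<open>A\<close>.\<close>

lemma minor_lift:
  assumes C: "set zs \<subseteq> {v} \<times> {0..n}" "distinct zs"
    and c: "c \<in> {v} \<times> {0..n} - set zs" "c' \<in> {v} \<times> {0..n} - set zs"
    and rs: "distinct rs" "distinct cs" "length rs = length cs"
    and v: "v \<in> set rs \<or> v \<in> set cs" "v \<in> set rs \<and> v \<in> set cs \<Longrightarrow> c \<noteq> c'"
  shows "minor (blowup fst A (D n)) (zs @ lift c rs) (zs @ lift c' cs) = (\<Prod>c\<in>set zs. D n c) * minor A rs cs"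
proof -
  have f: "fst c = v" "fst c' = v" "\<And>e. e \<in> set zs \<Longrightarrow> fst e = v" using c C by auto
  have dist: "distinct ([] @ zs @ lift c rs)" "distinct ([] @ zs @ lift c' cs)"
    using f c C rs distinct_lift[of c rs] distinct_lift[of c' cs] in_set_lift[of _ c rs] in_set_lift[of _ c' cs] by auto
  have "minor (blowup fst A (D n)) ([] @ zs @ lift c rs) ([] @ zs @ lift c' cs) =
    (\<Prod>c\<in>set zs. D n c) * minor (blowup fst A (D n)) ([] @ lift c rs) ([] @ lift c' cs)"
  proof (cases "v \<in> set rs")
    case True
    \<comment> \<open>A copy common to both lists would require \<open>v\<close> in both and
      \<open>c = c'\<close>.\<close>
    then have "c \<notin> set (lift c' cs)" using v in_set_lift[of c c' cs] f by auto
    then show ?thesis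
      by (intro minor_blowup_remove_rows[where r = c] dist) (use True in_set_lift[of c c rs] f rs in auto)
  next
    case False
    then have "v \<in> set cs" "c' \<notin> set (lift c rs)" using v in_set_lift[of c' c rs] f by auto
    then show ?thesis
      by (intro minor_blowup_remove_cols[where r = c'] dist) (use in_set_lift[of c' c' cs] f rs in auto)
  qed
  moreover have "minor (blowup fst A (D n)) (lift c rs) (lift c' cs) = minor A (map fst (lift c rs)) (map fst (lift c' cs))"
  proof (rule minor_blowup_const)
    fix u assume "u \<in> set (lift c rs)" "u \<in> set (lift c' cs)"
    then have "fst u \<noteq> v" using in_set_lift[of u c rs] in_set_lift[of u c' cs] f v by auto
    then show "D n u = 0" by (rule D_not_copy)
  qed (use rs in simp)
  ultimately show ?thesis using f by (simp only: map_fst_lift append_Nil)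
qed

text \<open>With \<open>v\<close> absent from both lists there is no reference row, and
  \<open>minor_blowup_expand\<close> applies. In its correction terms the diagonal entry of
  \<open>e\<close> has been set to 0, so they become minors of \<open>A\<close> that contain
  \<open>v\<close>, independently of \<open>e\<close>.\<close>

lemma minor_lift_expand:
  assumes C: "set zs \<subseteq> {v} \<times> {0..n}" "distinct zs"
    and c: "c \<in> {v} \<times> {0..n}"
    and rs: "distinct rs" "distinct cs" "length rs = length cs" "v \<notin> set rs" "v \<notin> set cs"
  shows "minor (blowup fst A (D n)) (zs @ lift c rs) (zs @ lift c cs) = (\<Prod>c\<in>set zs. D n c) * minor A rs cs +
    (\<Sum>e\<in>set zs. (\<Prod>c\<in>set zs - {e}. D n c) * minor A (v # rs) (v # cs))"
proof -
  have f: "fst c = v" "\<And>e. e \<in> set zs \<Longrightarrow> fst e = v" using c C by auto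
  have no: "fst u \<noteq> v" if "u \<in> set (lift c rs) \<or> u \<in> set (lift c cs)" for u
    using that in_set_lift[of u c rs] in_set_lift[of u c cs] f rs by auto
  have dist: "distinct (zs @ lift c rs)" "distinct (zs @ lift c cs)"
    using C(2) distinct_lift[OF f(1) rs(1)] distinct_lift[OF f(1) rs(2)] no f(2)
    unfolding distinct_append by blast+
  have "minor (blowup fst A (D n)) (lift c rs) (lift c cs) = minor A (map fst (lift c rs)) (map fst (lift c cs))"
    by (rule minor_blowup_const) (use rs no D_not_copy in auto)
  moreover have entry: "minor (blowup fst A ((D n)(e := 0))) (e # lift c rs) (e # lift c cs) = minor A (v # rs) (v # cs)"
    if e: "e \<in> set zs" for e
  proof -
    have "minor (blowup fst A ((D n)(e := 0))) (e # lift c rs) (e # lift c cs) =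
        minor A (map fst (e # lift c rs)) (map fst (e # lift c cs))"
    proof (rule minor_blowup_const)
      fix u assume "u \<in> set (e # lift c rs)"
      then have "u = e \<or> u \<in> set (lift c rs)" unfolding list.set by blast
      then have "u = e \<or> fst u \<noteq> v" using no by blast
      then show "((D n)(e := 0)) u = 0" by (auto simp: D_not_copy)
    qed (use rs in simp)
    moreover have "map fst (e # lift c rs) = v # rs" "map fst (e # lift c cs) = v # cs"
      using map_fst_lift[OF f(1)] f(2)[OF e] by (simp_all only: list.map)
    ultimately show ?thesis by (simp only:)
  qed
  moreover have "minor (blowup fst A (D n)) (zs @ lift c rs) (zs @ lift c cs) =
      (\<Prod>c\<in>set zs. D n c) * minor (blowup fst A (D n)) (lift c rs) (lift c cs) +
      (\<Sum>e\<in>set zs. (\<Prod>c\<in>set zs - {e}. D n c) * minor (blowup fst A ((D n)(e := 0))) (e # lift c rs) (e # lift c cs))"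
    by (rule minor_blowup_expand[OF _ dist f(2)]) (use rs in simp)
  moreover have "(\<Sum>e\<in>set zs. (\<Prod>c\<in>set zs - {e}. D n c) * minor (blowup fst A ((D n)(e := 0))) (e # lift c rs) (e # lift c cs)) =
      (\<Sum>e\<in>set zs. (\<Prod>c\<in>set zs - {e}. D n c) * minor A (v # rs) (v # cs))"
    by (rule sum.cong[OF refl]) (simp only: entry)
  ultimately show ?thesis by (simp only: map_fst_lift[OF f(1)])
qed

text \<open>Strong induction on the number of factors. The hypothesis \<open>room\<close> either
  leaves two copies outside every \<open>C\<close>, or supplies the unit ideal needed when
  \<open>C\<close> uses all copies but one.\<close>

lemma prod_D_mult_minor_in_critical_ideal:
  assumes n: "1 \<le> n" "k \<le> n"
    and room: "k < n \<or> (1 :: ('v \<times> nat, 'a) mpoly) \<in> Idl\<^bsub>poly_ring W0\<^esub> (minors (verts G - {v}) g A)"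
    and C: "C \<subseteq> {v} \<times> {0..n}" "card C = l" "l \<le> k"
    and m: "m \<in> minors (verts G) (g + k - l) A"
  shows "(\<Prod>c\<in>C. D n c) * m \<in> (critical_ideal (H n) (replicate_sign sg) (g + k) :: ('v \<times> nat, 'a) mpoly set)"
    (is "_ \<in> ?I")
  using C m
proof (induction l arbitrary: C m rule: less_induct)
  case (less l)
  let ?B = "blowup fst A (D n) :: _ \<Rightarrow> _ \<Rightarrow> ('v \<times> nat, 'a) mpoly"
  have I: "ideal ?I (poly_ring (verts (H n)))"
    unfolding critical_ideal_H by (rule ideal_Idl[OF minors_H_in_poly_ring])
  have fin: "finite C" using less.prems(1) by (rule finite_subset) simp
  obtain zs where zs: "set zs = C" "distinct zs" using finite_distinct_list[OF fin] by blast
  have len_zs: "length zs = l" using zs less.prems(2) distinct_card by fastforce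
  have card: "card ({v} \<times> {0..n} - C) = Suc n - l"
    using less.prems fin by (simp add: card_Diff_subset card_cartesian_product)
  have copy_f: "fst c = v" if "c \<in> {v} \<times> {0..n}" for c using that by auto
  have CH: "C \<subseteq> verts (H n)" using less.prems(1) by (auto simp: verts_H)
  have mem: "minor ?B (zs @ lift c rs) (zs @ lift c' cs) \<in> ?I"
    if c: "c \<in> {v} \<times> {0..n} - C" "c' \<in> {v} \<times> {0..n} - C" and
      rs: "distinct rs" "set rs \<subseteq> verts G" "length rs = g + k - l" and
      cs: "distinct cs" "set cs \<subseteq> verts G" "length cs = g + k - l" for c c' rs cs
  proof -
    have dist: "distinct (zs @ lift c rs)"
      if c: "c \<in> {v} \<times> {0..n} - C" and rs: "distinct rs" for c rs
    proof -
      have "e \<notin> set (lift c rs)" if "e \<in> C" for e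
        using that c less.prems(1) copy_f in_set_lift[of e c rs] by blast
      then show ?thesis
        using zs distinct_lift[OF copy_f rs, of c] c unfolding distinct_append by blast
    qed
    have "minor ?B (zs @ lift c rs) (zs @ lift c' cs) \<in> minors (verts (H n)) (g + k) ?B"
    proof (rule minorsI)
      show "set (zs @ lift c rs) \<subseteq> verts (H n)" "set (zs @ lift c' cs) \<subseteq> verts (H n)"
        using CH zs set_lift[of c n rs] set_lift[of c' n cs] c rs cs by (simp_all add: set_append)
    qed (use dist[OF c(1) rs(1)] dist[OF c(2) cs(1)] rs cs len_zs less.prems(3) in auto)
    then show ?thesis unfolding critical_ideal_H using Idl_superset[OF minors_H_in_poly_ring] by blast
  qed
  have avoid: "(\<Prod>c\<in>C. D n c) * minor A rs cs \<in> ?I"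
    if rs: "distinct rs" "set rs \<subseteq> verts G" "length rs = g + k - l" and
      cs: "distinct cs" "set cs \<subseteq> verts G" "length cs = g + k - l" and v: "v \<notin> set rs" "v \<notin> set cs" for rs cs
  proof -
    have "{v} \<times> {0..n} - C \<noteq> {}" using card less.prems(3) n by (intro notI) simp
    then obtain c where c: "c \<in> {v} \<times> {0..n} - C" by blast
    let ?S = "\<Sum>e\<in>set zs. (\<Prod>c\<in>set zs - {e}. D n c) * minor A (v # rs) (v # cs) :: ('v \<times> nat, 'a) mpoly"
    have eq: "minor ?B (zs @ lift c rs) (zs @ lift c cs) = (\<Prod>c\<in>set zs. D n c) * minor A rs cs + ?S"
      by (rule minor_lift_expand) (use zs less.prems rs cs v c in auto)
    \<comment> \<open>One factor fewer and one row and column more: the total size is unchanged, so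
      the induction hypothesis for \<open>l - 1\<close> covers each summand.\<close>
    have S: "?S \<in> ?I"
    proof (rule ideal_poly_ring_sum[OF I])
      fix e assume e: "e \<in> set zs"
      then have l: "0 < l" using len_zs by (cases zs) auto
      show "(\<Prod>c\<in>set zs - {e}. D n c) * minor A (v # rs) (v # cs) \<in> ?I"
      proof (rule less.IH[of "l - 1"])
        show "minor A (v # rs) (v # cs) \<in> minors (verts G) (g + k - (l - 1)) A"
          by (rule minorsI) (use rs cs v v_in_verts l less.prems(3) in auto)
      qed (use e l zs less.prems fin in auto)
    qed
    have "(\<Prod>c\<in>C. D n c) * minor A rs cs = minor ?B (zs @ lift c rs) (zs @ lift c cs) + - ?S"
      unfolding eq zs by simp
    also have "\<dots> \<in> ?I"
      by (intro ideal_poly_ring_add[OF I] ideal_poly_ring_uminus[OF I] S mem c rs cs)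
    finally show ?thesis .
  qed
  obtain rs cs where m: "m = minor A rs cs" and
    rs: "distinct rs" "set rs \<subseteq> verts G" "length rs = g + k - l" and
    cs: "distinct cs" "set cs \<subseteq> verts G" "length cs = g + k - l"
    using less.prems(4) by (auto elim: minorsE)
  \<comment> \<open>Outside the first two cases \<open>v\<close> occurs in both lists and
    \<open>l\<close> is not below \<open>n\<close>, which with the bounds on \<open>l\<close> forces
    equality.\<close>
  consider "v \<notin> set rs" "v \<notin> set cs" | "v \<in> set rs \<or> v \<in> set cs" "\<not> (v \<in> set rs \<and> v \<in> set cs) \<or> l < n"
    | "l = n" using less.prems(3) n by linarith
  then show ?case
  proof cases
    case 1
    then show ?thesis unfolding m by (intro avoid rs cs)
  next
    case 2
    have "\<exists>c c'. c \<in> {v} \<times> {0..n} - C \<and> c' \<in> {v} \<times> {0..n} - C \<and> (v \<in> set rs \<and> v \<in> set cs \<longrightarrow> c \<noteq> c')"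
    proof (cases "l < n")
      case True
      \<comment> \<open>Of the \<open>n + 1\<close> copies, at least two remain when
        \<open>l < n\<close>.\<close>
      then have "2 \<le> card ({v} \<times> {0..n} - C)" using card by simp
      then obtain T where T: "T \<subseteq> {v} \<times> {0..n} - C" "card T = 2" by (rule obtain_subset_with_card_n)
      then obtain c c' where "T = {c, c'}" "c \<noteq> c'" unfolding card_2_iff by blast
      then show ?thesis using T(1) by blast
    next
      case False
      have "{v} \<times> {0..n} - C \<noteq> {}" using card less.prems(3) n by (intro notI) simp
      then show ?thesis using 2 False by blast
    qed
    then obtain c c' where c: "c \<in> {v} \<times> {0..n} - C" "c' \<in> {v} \<times> {0..n} - C"
      "v \<in> set rs \<and> v \<in> set cs \<Longrightarrow> c \<noteq> c'" by blast
    have "minor ?B (zs @ lift c rs) (zs @ lift c' cs) = (\<Prod>c\<in>set zs. D n c) * minor A rs cs"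
      by (rule minor_lift) (use zs less.prems rs cs 2 c in auto)
    then show ?thesis using mem[OF c(1,2) rs cs] unfolding m zs by simp
  next
    case 3
    then have k: "k = n" "l = k" using less.prems(3) n by auto
    then have "(1 :: ('v \<times> nat, 'a) mpoly) \<in> Idl\<^bsub>poly_ring W0\<^esub> (minors (verts G - {v}) g A)" using room by simp
    \<comment> \<open>Here \<open>g + k - l = g\<close>. Writing 1 as a combination of minors of
      size \<open>g\<close> avoiding \<open>v\<close>, to which \<open>avoid\<close> applies, puts
      the bare product into the ideal; multiplying by \<open>m\<close> then finishes the
      case.\<close>
    then have "(\<Prod>c\<in>C. D n c) * 1 \<in> ?I" using minors_A_in_poly_ring[OF Diff_subset]
    proof (induction rule: Idl_induct)
      case (gen s)
      then obtain rs cs where "s = minor A rs cs" "distinct rs" "set rs \<subseteq> verts G - {v}" "length rs = g"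
        "distinct cs" "set cs \<subseteq> verts G - {v}" "length cs = g" by (rule minorsE)
      then show ?case using avoid[of rs cs] k by auto
    next
      case (mult a b)
      then have "a \<in> carrier (poly_ring (verts (H n)))" by (auto simp: mem_poly_ring verts_H)
      then show ?case using ideal_poly_ring_mult[OF I _ mult(2)] by (simp add: mult.left_commute)
    qed (auto simp: distrib_left intro: ideal_poly_ring_0[OF I] ideal_poly_ring_add[OF I])
    moreover have "m \<in> carrier (poly_ring (verts (H n)))"
      using less.prems(4) minors_A_in_poly_ring_H[OF subset_refl] by blast
    ultimately show ?thesis using ideal_poly_ring_mult[OF I] by (simp add: mult.commute)
  qed
qed

section \<open>The replication formula and the bounds on the co-ranks\<close>

lemma critical_ideal_H_eq:
  assumes n: "1 \<le> n" "k \<le> n"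
    and one: "(1 :: ('v \<times> nat, 'a) mpoly) \<in> Idl\<^bsub>poly_ring W0\<^esub> (minors (verts G) g A)"
    and room: "k < n \<or> (1 :: ('v \<times> nat, 'a) mpoly) \<in> Idl\<^bsub>poly_ring W0\<^esub> (minors (verts G - {v}) g A)"
  shows "(critical_ideal (H n) (replicate_sign sg) (g + k) :: ('v \<times> nat, 'a) mpoly set) =
    Idl\<^bsub>poly_ring (verts (H n))\<^esub> (mixed_products n g k)"
proof
  let ?I = "critical_ideal (H n) (replicate_sign sg) (g + k) :: ('v \<times> nat, 'a) mpoly set"
  have I: "ideal ?I (poly_ring (verts (H n)))"
    unfolding critical_ideal_H by (rule ideal_Idl[OF minors_H_in_poly_ring])
  show "?I \<subseteq> Idl\<^bsub>poly_ring (verts (H n))\<^esub> (mixed_products n g k)"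
    by (rule critical_ideal_H_subset[OF one])
  have "(mixed_products n g k :: ('v \<times> nat, 'a) mpoly set) \<subseteq> ?I"
  proof
    fix x :: "('v \<times> nat, 'a) mpoly" assume "x \<in> mixed_products n g k"
    then obtain C z where x: "x = (\<Prod>c\<in>C. D n c) * z" "C \<subseteq> {v} \<times> {0..n}" "card C \<le> k"
      and z: "z \<in> Idl\<^bsub>poly_ring (verts (H n))\<^esub> (minors (verts G) (g + k - card C) A)"
      by (rule mixed_productsE)
    \<comment> \<open>The \<open>z\<close> whose multiple by the fixed product lies in
      \<open>?I\<close> are closed under the ideal operations, so it suffices to treat
      minors.\<close>
    show "x \<in> ?I" unfolding x(1) using z minors_A_in_poly_ring_H[OF subset_refl]
    proof (induction rule: Idl_induct)
      case (gen m)
      then show ?case by (rule prod_D_mult_minor_in_critical_ideal[OF n room x(2) refl x(3)])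
    next
      case (mult a b)
      then show ?case using ideal_poly_ring_mult[OF I mult] by (simp add: mult.left_commute)
    qed (auto simp: distrib_left intro: ideal_poly_ring_0[OF I] ideal_poly_ring_add[OF I])
  qed
  then show "Idl\<^bsub>poly_ring (verts (H n))\<^esub> (mixed_products n g k) \<subseteq> ?I"
    by (rule Idl_least[OF mixed_products_in_poly_ring I])
qed

end

theorem theorem3p8:
  fixes G :: "('v, 'e) pre_digraph" and sg :: "'e \<Rightarrow> int" and v :: 'v
    and P :: "'a::idom itself"
  assumes "principal_domain (class_ring :: 'a ring)"
    and "signed_multidigraph G sg"
    and "v \<in> verts G"
    and "alg_corank P G sg \<ge> 2"
  shows
    "let \<gamma>\<^sub>r = alg_corank P (replicate_vert G v 1) (replicate_sign sg);
         \<gamma>\<^sub>v = alg_corank P (pre_digraph.del_vert G v) sg;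
         lam = (if \<gamma>\<^sub>v = \<gamma>\<^sub>r then 0 else 1 :: nat)
     in 0 \<le> int \<gamma>\<^sub>r - int \<gamma>\<^sub>v \<and> int \<gamma>\<^sub>r - int \<gamma>\<^sub>v \<le> 2 \<and>
        (\<forall>k \<ge> 1. \<forall>i \<ge> 0.
           let H = replicate_vert G v (k + lam + i)
           in (critical_ideal H (replicate_sign sg) (\<gamma>\<^sub>r + k) :: ('v \<times> nat, 'a) mpoly set) =
              Idl\<^bsub>poly_ring (verts H)\<^esub>
                (\<Union>l \<in> {0..k}. P_tilde v (k + lam + i) l <#>\<^bsub>poly_ring (verts H)\<^esub>
                   ideal_at_minus_one (verts H) v (critical_ideal G sg (\<gamma>\<^sub>r + k - l))))"
proof -
  interpret replicated_vertex G sg v P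
    using assms by (intro replicated_vertex.intro replicated_vertex_axioms.intro)
  define gr where "gr = alg_corank P (H 1) (replicate_sign sg)"
  define gv where "gv = alg_corank P (del_vert v) sg"
  have fin: "finite (verts (del_vert v))" by (simp add: verts_del_vert)
  have A: "(1 :: ('v \<times> nat, 'a) mpoly) \<in> Idl\<^bsub>poly_ring W0\<^esub> (minors (verts G) gr A)"
    using one_in_Idl_minors_A one_in_critical_ideal_corank[OF finite_verts_H] unfolding gr_def by blast
  have M: "(1 :: ('v \<times> nat, 'a) mpoly) \<in> Idl\<^bsub>poly_ring W0\<^esub> (minors (verts G - {v}) gv A)"
    using one_in_critical_ideal_corank[OF fin] unfolding gv_def one_in_critical_ideal_del_vert_iff[symmetric] by blast
  have "gv \<le> gr" unfolding gr_def
    by (rule le_alg_corank[OF finite_verts_H one_in_critical_ideal_H[OF M]])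
  moreover have "gr \<le> gv + 2"
  \<comment> \<open>Natural subtraction makes \<open>gr - 2\<close> meaningful only here; for
    smaller \<open>gr\<close> the bound is immediate.\<close>
  proof (cases "2 \<le> gr")
    case True
    then have "gr - 2 + 2 = gr" by simp
    then have "(1 :: ('v \<times> nat, 'a) mpoly) \<in> Idl\<^bsub>poly_ring W0\<^esub> (minors (verts G - {v}) (gr - 2) A)"
      using A by (intro one_in_Idl_minors_A_minus_2) (simp only:)
    then have "gr - 2 \<le> gv" unfolding gv_def
      by (intro le_alg_corank[OF fin]) (simp add: one_in_critical_ideal_del_vert_iff)
    then show ?thesis by simp
  qed simp
  \<comment> \<open>If \<open>lam = 1\<close> or \<open>i > 0\<close>, then \<open>k\<close> is
    smaller than the number of replications. Otherwise \<open>gv = gr\<close>, and \<open>M\<close>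
    supplies the unit ideal of minors avoiding \<open>v\<close>.\<close>
  moreover have "(critical_ideal (H (k + lam + i)) (replicate_sign sg) (gr + k) :: ('v \<times> nat, 'a) mpoly set) =
      Idl\<^bsub>poly_ring (verts (H (k + lam + i)))\<^esub> (mixed_products (k + lam + i) gr k)"
    if "1 \<le> k" "lam = (if gv = gr then 0 else 1)" for k i lam
    by (rule critical_ideal_H_eq) (use that A M in \<open>auto split: if_splits\<close>)
  ultimately show ?thesis
    unfolding Let_def gr_def[symmetric] gv_def[symmetric] ideal_at_minus_one_eq mixed_products_def
    by auto
qed

end
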